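(* Let $F\xrightarrow{\iota}E\xrightarrow{\pi}B$ be a fibration over a well-pointed path-connected space $B$ (so $\pi$ is a fibration and $\iota$ is the inclusion of its fibre $F$ over the base point). Suppose that there exists a commutative square $$\begin{array}{ccc} A & \longrightarrow & C\\ {\scriptstyle f}\downarrow & & \downarrow{\scriptstyle g}\\ F & \xrightarrow{\ \iota\ } & E\end{array}$$ in which $f:A\to F$ and $g:C\to E$ are cofibrations. Then, for any $k\geq 0$, $$Q^k\mathrm{secat}(g)\leq (Q^k\mathrm{cat}(B)+1)(\mathrm{secat}(f)+1)-1.$$
   Context: Conventions. All spaces are compactly generated Hausdorff spaces having the homotopy type of a CW-complex (constructions are made in the compactly generated category); $I=[0,1]$. Every cofibration $f:A\to X$ considered is a closed pointed cofibration whose target $X$ is a well-pointed path-connected space (here in particular $F$ and $E$ are well-pointed and path-connected). All invariants below take values in $\{0,1,2,\dots\}\cup\{\infty\}$. Sectional category. For a map $f:A\to X$, $\mathrm{secat}(f)$ is the least integer $n$ (or $\infty$) for which there is an open cover $U_0,\dots,U_n$ of $X$ such that on each $U_i$ there is a continuous map $s_i:U_i\to A$ with $f\circ s_i$ homotopic to the inclusion $U_i\hookrightarrow X$. Ganea fibrations. For a cofibration $f:A\to X$ and $n\ge 0$, let $\Gamma_n(X)=\{(\gamma_0,\dots,\gamma_n)\in (X^I)^{n+1} : \gamma_0(0)=\dots=\gamma_n(0)\}$, $G_n(f)=\{(\gamma_0,\dots,\gamma_n)\in\Gamma_n(X) : \exists j,\ \gamma_j(1)\in f(A)\}$, and let $g_n(f):G_n(f)\to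 X$ be the fibration $(\gamma_0,\dots,\gamma_n)\mapsto\gamma_0(0)$. Fibrewise $Q$ construction. Let $p:E\to B$ be a fibration over a path-connected space and $k\geq 0$. Let $\Sigma^k_BE=(E\times I^k)/\sim$, where $\sim$ is generated by $(e,t_1,\dots,t_k)\sim(e',t'_1,\dots,t'_k)$ if $p(e)=p(e')$ and, for some $i$, $t_i=t'_i\in\{0,1\}$ and $t_j=t'_j$ for all $j>i$; classes are written $[e,t_1,\dots,t_k]$. Let $\hat p^k:\Sigma^k_BE\to B$, $[e,t]\mapsto p(e)$, and $\mu^k:B\times\partial I^k\to\Sigma^k_BE$, $\mu^k(b,t)=[e,t]$ for any $e$ with $p(e)=b$. Set $$Q^k_B(E)=\{\omega:I^k\to\Sigma^k_BE : \exists b\in B,\ \hat p^k\omega=b \text{ (constant) and } \omega|_{\partial I^k}=\mu^k(b,-)\}\subset(\Sigma^k_BE)^{I^k},$$ with the fibration $q^k(p):Q^k_B(E)\to B$, $\omega\mapsto\hat p^k\omega(0)$. For $k=0$, $Q^0_B(E)=E$ and $q^0(p)=p$. $Q$-invariants. For a cofibration $f:A\to X$, $Q^k\mathrm{secat}(f)$ is the least integer $n$ (or $\infty$) such that $q^k(g_n(f)):Q^k_X(G_n(f))\to X$ admits a (homotopy) section; one has $Q^0\mathrm{secat}(f)=\mathrm{secat}(f)$. For a well-pointed path-connected space $B$, $Q^k\mathrm{cat}(B)=Q^k\mathrm{secat}(\ast\to B)$, where $\ast\to B$ is the inclusion of the base point. *)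

theory Defs
  imports "HOL-Analysis.Analysis" "HOL-Library.Extended_Nat"
begin

section \<open>Compactly generated Hausdorff spaces and CW homotopy type\<close>

definition cg_hausdorff :: "'a topology \<Rightarrow> bool" where
  "cg_hausdorff X \<longleftrightarrow> k_space X \<and> Hausdorff_space X"

definition unit_disc :: "nat \<Rightarrow> (nat \<Rightarrow> real) topology" where
  "unit_disc n = subtopology (Euclidean_space n) {x. (\<Sum>i<n. (x i)\<^sup>2) \<le> 1}"

definition open_disc :: "nat \<Rightarrow> (nat \<Rightarrow> real) set" where
  "open_disc n = {x \<in> topspace (unit_disc n). (\<Sum>i<n. (x i)\<^sup>2) < 1}"

text \<open>A cell is a pair of its dimension \<open>n\<close> and its characteristic map \<open>\<phi>\<close>, of which only the
  values on the closed unit disc matter.  That \<open>\<phi>\<close> is a homeomorphism from the open disc onto its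
  image is automatic, the space being Hausdorff and the open cells disjoint.\<close>

definition CW_complex :: "'a topology \<Rightarrow> bool" where
  "CW_complex X \<longleftrightarrow> Hausdorff_space X \<and>
    (\<exists>cells :: (nat \<times> ((nat \<Rightarrow> real) \<Rightarrow> 'a)) set.
       (\<forall>(n, \<phi>) \<in> cells. continuous_map (unit_disc n) X \<phi> \<and> inj_on \<phi> (open_disc n)) \<and>
       disjoint_family_on (\<lambda>(n, \<phi>). \<phi> ` open_disc n) cells \<and>
       (\<Union>(n, \<phi>) \<in> cells. \<phi> ` open_disc n) = topspace X \<and>
       (\<forall>(n, \<phi>) \<in> cells. \<exists>lower \<subseteq> cells. finite lower \<and> (\<forall>(m, \<psi>) \<in> lower. m < n) \<and>
          \<phi> ` (topspace (unit_disc n) - open_disc n) \<subseteq> (\<Union>(m, \<psi>) \<in> lower. \<psi> ` open_disc m)) \<and>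
       (\<forall>S \<subseteq> topspace X.
          (\<forall>(n, \<phi>) \<in> cells. closedin X (S \<inter> \<phi> ` topspace (unit_disc n))) \<longrightarrow> closedin X S))"

text \<open>The type of the CW-complex is no restriction: if \<open>Y\<close> is a CW-complex of any size and
  \<open>X \<rightarrow> Y \<rightarrow> X\<close> are inverse homotopy equivalences, then closing the image of \<open>X\<close> up under
  finite subcomplexes and under the homotopy on \<open>Y\<close> gives a subcomplex, still homotopy equivalent
  to \<open>X\<close>, with at most \<open>max |X| |\<real>|\<close> points.\<close>

definition CW_type :: "'a topology \<Rightarrow> bool" where
  "CW_type X \<longleftrightarrow> (\<exists>Y :: ('a \<times> real) topology. CW_complex Y \<and> X homotopy_equivalent_space Y)"

definition admissible_space :: "'a topology \<Rightarrow> bool" where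
  "admissible_space X \<longleftrightarrow> cg_hausdorff X \<and> CW_type X"


section \<open>Fibrations and cofibrations\<close>

abbreviation unit_interval :: "real topology" where
  "unit_interval \<equiv> top_of_set {0..1}"

text \<open>The homotopy lifting (extension) property is meant with respect to all compactly generated
  Hausdorff spaces \<open>Z\<close>.  HOL cannot quantify over types, but the types chosen for \<open>Z\<close> carry the
  universal test spaces \<open>{(e, \<gamma>). p e = \<gamma> 0}\<close> and the mapping cylinder of \<open>f\<close> respectively,
  so the properties hold for \<open>Z\<close> of arbitrary type.\<close>

definition fibration :: "'e topology \<Rightarrow> 'b topology \<Rightarrow> ('e \<Rightarrow> 'b) \<Rightarrow> bool" where
  "fibration E B p \<longleftrightarrow> continuous_map E B p \<and>
    (\<forall>(Z :: ('e \<times> (real \<Rightarrow> 'b)) topology) h H.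
       cg_hausdorff Z \<and> continuous_map Z E h \<and>
       continuous_map (prod_topology unit_interval Z) B H \<and>
       (\<forall>z \<in> topspace Z. H (0, z) = p (h z)) \<longrightarrow>
       (\<exists>K. continuous_map (prod_topology unit_interval Z) E K \<and>
          (\<forall>z \<in> topspace Z. K (0, z) = h z) \<and>
          (\<forall>t \<in> {0..1}. \<forall>z \<in> topspace Z. p (K (t, z)) = H (t, z))))"

definition cofibration :: "'a topology \<Rightarrow> 'x topology \<Rightarrow> ('a \<Rightarrow> 'x) \<Rightarrow> bool" where
  "cofibration A X f \<longleftrightarrow> continuous_map A X f \<and>
    (\<forall>(Z :: ('x + 'a \<times> real) topology) h H.
       cg_hausdorff Z \<and> continuous_map X Z h \<and>
       continuous_map (prod_topology unit_interval A) Z H \<and>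
       (\<forall>a \<in> topspace A. H (0, a) = h (f a)) \<longrightarrow>
       (\<exists>K. continuous_map (prod_topology unit_interval X) Z K \<and>
          (\<forall>x \<in> topspace X. K (0, x) = h x) \<and>
          (\<forall>t \<in> {0..1}. \<forall>a \<in> topspace A. K (t, f a) = H (t, a))))"

definition well_pointed :: "'a topology \<Rightarrow> 'a \<Rightarrow> bool" where
  "well_pointed X x0 \<longleftrightarrow> x0 \<in> topspace X \<and> closedin X {x0} \<and> cofibration (subtopology X {x0}) X id"

text \<open>A pointed cofibration is a base point preserving map with the (free) homotopy extension
  property.\<close>

definition admissible_cofibration ::
    "'a topology \<Rightarrow> 'a \<Rightarrow> 'x topology \<Rightarrow> 'x \<Rightarrow> ('a \<Rightarrow> 'x) \<Rightarrow> bool" where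
  "admissible_cofibration A a0 X x0 f \<longleftrightarrow>
     admissible_space A \<and> a0 \<in> topspace A \<and>
     admissible_space X \<and> well_pointed X x0 \<and> path_connected_space X \<and>
     cofibration A X f \<and> closed_map A X f \<and> f a0 = x0"


section \<open>Sectional category\<close>

definition secat :: "'a topology \<Rightarrow> 'x topology \<Rightarrow> ('a \<Rightarrow> 'x) \<Rightarrow> enat" where
  "secat A X f = Inf {enat n | n. \<exists>U. (\<forall>i\<le>n. openin X (U i)) \<and> (\<Union>i\<le>n. U i) = topspace X \<and>
     (\<forall>i\<le>n. \<exists>s. continuous_map (subtopology X (U i)) A s \<and>
        homotopic_with (\<lambda>_. True) (subtopology X (U i)) X (f \<circ> s) id)}"


section \<open>Constructions in the compactly generated category\<close>

definition cg_subspace :: "'a topology \<Rightarrow> 'a set \<Rightarrow> 'a topology" where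
  "cg_subspace X S = kification (subtopology X S)"

definition cg_prod :: "'a topology \<Rightarrow> 'b topology \<Rightarrow> ('a \<times> 'b) topology" where
  "cg_prod X Y = kification (prod_topology X Y)"

definition cg_product :: "('i \<Rightarrow> 'a topology) \<Rightarrow> 'i set \<Rightarrow> ('i \<Rightarrow> 'a) topology" where
  "cg_product X I = kification (product_topology X I)"

text \<open>Maps out of \<open>Y\<close> are represented by extensional functions, undefined off \<open>topspace Y\<close>.\<close>

definition maps :: "'y topology \<Rightarrow> 'x topology \<Rightarrow> ('y \<Rightarrow> 'x) set" where
  "maps Y X = {\<omega> \<in> extensional (topspace Y). continuous_map Y X \<omega>}"

definition compact_open_topology :: "'y topology \<Rightarrow> 'x topology \<Rightarrow> ('y \<Rightarrow> 'x) topology" where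
  "compact_open_topology Y X =
     topology_generated_by {{\<omega> \<in> maps Y X. \<omega> ` K \<subseteq> U} | K U. compactin Y K \<and> openin X U}"

definition mapping_space :: "'y topology \<Rightarrow> 'x topology \<Rightarrow> ('y \<Rightarrow> 'x) topology" where
  "mapping_space Y X = kification (compact_open_topology Y X)"

text \<open>Quotients of compactly generated spaces are compactly generated.\<close>

definition quotient_topology :: "'a topology \<Rightarrow> ('a \<Rightarrow> 'b) \<Rightarrow> 'b topology" where
  "quotient_topology X q =
     topology (\<lambda>U. U \<subseteq> q ` topspace X \<and> openin X {x \<in> topspace X. q x \<in> U})"


section \<open>Ganea fibrations\<close>

definition Gamma_set :: "nat \<Rightarrow> 'x topology \<Rightarrow> (nat \<Rightarrow> real \<Rightarrow> 'x) set" where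
  "Gamma_set n X = {\<gamma> \<in> {..n} \<rightarrow>\<^sub>E maps unit_interval X. \<forall>i\<le>n. \<gamma> i 0 = \<gamma> 0 0}"

definition ganea_space :: "nat \<Rightarrow> 'a topology \<Rightarrow> 'x topology \<Rightarrow> ('a \<Rightarrow> 'x) \<Rightarrow> (nat \<Rightarrow> real \<Rightarrow> 'x) topology"
  where "ganea_space n A X f =
    cg_subspace (cg_product (\<lambda>_. mapping_space unit_interval X) {..n})
      {\<gamma> \<in> Gamma_set n X. \<exists>j\<le>n. \<gamma> j 1 \<in> f ` topspace A}"

definition ganea_map :: "(nat \<Rightarrow> real \<Rightarrow> 'x) \<Rightarrow> 'x" where
  "ganea_map \<gamma> = \<gamma> 0 0"


section \<open>The fibrewise \<open>Q\<close> construction\<close>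

text \<open>Points of \<open>I\<^sup>k\<close> are extensional functions on \<open>{1..k}\<close>.\<close>

definition cube :: "nat \<Rightarrow> (nat \<Rightarrow> real) topology" where
  "cube k = product_topology (\<lambda>_. unit_interval) {1..k}"

definition cube_boundary :: "nat \<Rightarrow> (nat \<Rightarrow> real) set" where
  "cube_boundary k = {t \<in> topspace (cube k). \<exists>i \<in> {1..k}. t i \<in> {0, 1}}"

definition cube_origin :: "nat \<Rightarrow> nat \<Rightarrow> real" where
  "cube_origin k = restrict (\<lambda>_. 0) {1..k}"

definition Sigma_rel :: "nat \<Rightarrow> 'e topology \<Rightarrow> ('e \<Rightarrow> 'b) \<Rightarrow>
    'e \<times> (nat \<Rightarrow> real) \<Rightarrow> 'e \<times> (nat \<Rightarrow> real) \<Rightarrow> bool" where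
  "Sigma_rel k E p = (\<lambda>(e, t) (e', t').
     e \<in> topspace E \<and> e' \<in> topspace E \<and> t \<in> topspace (cube k) \<and> t' \<in> topspace (cube k) \<and>
     p e = p e' \<and>
     (\<exists>i \<in> {1..k}. t i = t' i \<and> t i \<in> {0, 1} \<and> (\<forall>j \<in> {1..k}. i < j \<longrightarrow> t j = t' j)))"

definition Sigma_class :: "nat \<Rightarrow> 'e topology \<Rightarrow> ('e \<Rightarrow> 'b) \<Rightarrow>
    'e \<times> (nat \<Rightarrow> real) \<Rightarrow> ('e \<times> (nat \<Rightarrow> real)) set" where
  "Sigma_class k E p x = {y. equivclp (Sigma_rel k E p) x y}"

definition Sigma_space :: "nat \<Rightarrow> 'e topology \<Rightarrow> ('e \<Rightarrow> 'b) \<Rightarrow> ('e \<times> (nat \<Rightarrow> real)) set topology"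
  where "Sigma_space k E p = quotient_topology (cg_prod E (cube k)) (Sigma_class k E p)"

text \<open>The choices of representatives in the next two definitions are immaterial, since equivalent
  pairs lie over the same point of \<open>B\<close>, and the class \<open>[e, t]\<close> with \<open>t\<close> in the boundary depends
  only on \<open>p e\<close> and \<open>t\<close>.\<close>

definition Sigma_proj :: "('e \<Rightarrow> 'b) \<Rightarrow> ('e \<times> (nat \<Rightarrow> real)) set \<Rightarrow> 'b" where
  "Sigma_proj p c = p (fst (SOME x. x \<in> c))"

definition Sigma_mu :: "nat \<Rightarrow> 'e topology \<Rightarrow> ('e \<Rightarrow> 'b) \<Rightarrow>
    'b \<Rightarrow> (nat \<Rightarrow> real) \<Rightarrow> ('e \<times> (nat \<Rightarrow> real)) set" where
  "Sigma_mu k E p b t = Sigma_class k E p (SOME e. e \<in> topspace E \<and> p e = b, t)"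

definition Q_space :: "nat \<Rightarrow> 'e topology \<Rightarrow> 'b topology \<Rightarrow> ('e \<Rightarrow> 'b) \<Rightarrow>
    ((nat \<Rightarrow> real) \<Rightarrow> ('e \<times> (nat \<Rightarrow> real)) set) topology" where
  "Q_space k E B p = cg_subspace (mapping_space (cube k) (Sigma_space k E p))
     {\<omega> \<in> maps (cube k) (Sigma_space k E p).
        \<exists>b \<in> topspace B. (\<forall>t \<in> topspace (cube k). Sigma_proj p (\<omega> t) = b) \<and>
                        (\<forall>t \<in> cube_boundary k. \<omega> t = Sigma_mu k E p b t)}"

definition Q_map :: "nat \<Rightarrow> ('e \<Rightarrow> 'b) \<Rightarrow> ((nat \<Rightarrow> real) \<Rightarrow> ('e \<times> (nat \<Rightarrow> real)) set) \<Rightarrow> 'b" where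
  "Q_map k p \<omega> = Sigma_proj p (\<omega> (cube_origin k))"


section \<open>The \<open>Q\<close>-invariants\<close>

text \<open>For a fibration \<open>q\<close>, having a homotopy section is the same as having a section.\<close>

definition has_homotopy_section :: "'e topology \<Rightarrow> 'b topology \<Rightarrow> ('e \<Rightarrow> 'b) \<Rightarrow> bool" where
  "has_homotopy_section E B q \<longleftrightarrow>
     (\<exists>s. continuous_map B E s \<and> homotopic_with (\<lambda>_. True) B B (q \<circ> s) id)"

definition Q_secat :: "nat \<Rightarrow> 'a topology \<Rightarrow> 'x topology \<Rightarrow> ('a \<Rightarrow> 'x) \<Rightarrow> enat" where
  "Q_secat k A X f = Inf {enat n | n.
     has_homotopy_section (Q_space k (ganea_space n A X f) X ganea_map) X (Q_map k ganea_map)}"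

definition Q_cat :: "nat \<Rightarrow> 'b topology \<Rightarrow> 'b \<Rightarrow> enat" where
  "Q_cat k B b0 = Q_secat k (subtopology B {b0}) B id"


section \<open>The topologies and classes are well defined\<close>

lemma istopology_quotient_topology:
  "istopology (\<lambda>U. U \<subseteq> q ` topspace X \<and> openin X {x \<in> topspace X. q x \<in> U})"
  unfolding istopology_def
proof (intro conjI allI impI)
  fix S T
  assume S: "S \<subseteq> q ` topspace X \<and> openin X {x \<in> topspace X. q x \<in> S}"
    and T: "T \<subseteq> q ` topspace X \<and> openin X {x \<in> topspace X. q x \<in> T}"
  show "S \<inter> T \<subseteq> q ` topspace X" using S by blast
  have "openin X ({x \<in> topspace X. q x \<in> S} \<inter> {x \<in> topspace X. q x \<in> T})"
    by (rule openin_Int) (use S T in blast)+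
  moreover have "{x \<in> topspace X. q x \<in> S} \<inter> {x \<in> topspace X. q x \<in> T} =
      {x \<in> topspace X. q x \<in> S \<inter> T}" by blast
  ultimately show "openin X {x \<in> topspace X. q x \<in> S \<inter> T}" by simp
next
  fix \<K>
  assume \<K>: "\<forall>S\<in>\<K>. S \<subseteq> q ` topspace X \<and> openin X {x \<in> topspace X. q x \<in> S}"
  show "\<Union>\<K> \<subseteq> q ` topspace X" using \<K> by blast
  have "openin X (\<Union>S\<in>\<K>. {x \<in> topspace X. q x \<in> S})" by (rule openin_Union) (use \<K> in blast)
  moreover have "(\<Union>S\<in>\<K>. {x \<in> topspace X. q x \<in> S}) = {x \<in> topspace X. q x \<in> \<Union>\<K>}" by blast
  ultimately show "openin X {x \<in> topspace X. q x \<in> \<Union>\<K>}" by simp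
qed

lemma openin_quotient_topology:
  "openin (quotient_topology X q) U \<longleftrightarrow>
     U \<subseteq> q ` topspace X \<and> openin X {x \<in> topspace X. q x \<in> U}"
  unfolding quotient_topology_def
  by (subst topology_inverse'[OF istopology_quotient_topology]) (rule refl)

lemma topspace_quotient_topology [simp]: "topspace (quotient_topology X q) = q ` topspace X"
proof
  show "topspace (quotient_topology X q) \<subseteq> q ` topspace X"
    using openin_topspace[of "quotient_topology X q"] unfolding openin_quotient_topology by blast
  have "{x \<in> topspace X. q x \<in> q ` topspace X} = topspace X" by blast
  then have "openin (quotient_topology X q) (q ` topspace X)"
    unfolding openin_quotient_topology by simp
  then show "q ` topspace X \<subseteq> topspace (quotient_topology X q)" by (rule openin_subset)
qed

lemma quotient_map_quotient_topology: "quotient_map X (quotient_topology X q) q"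
  unfolding quotient_map_def by (simp add: openin_quotient_topology)

lemma topspace_compact_open_topology [simp]: "topspace (compact_open_topology Y X) = maps Y X"
proof
  let ?G = "{{\<omega> \<in> maps Y X. \<omega> ` K \<subseteq> U} | K U. compactin Y K \<and> openin X U}"
  have *: "topspace (compact_open_topology Y X) = \<Union>?G"
    unfolding compact_open_topology_def by (rule topology_generated_by_topspace)
  show "topspace (compact_open_topology Y X) \<subseteq> maps Y X" unfolding * by blast
  have "maps Y X = {\<omega> \<in> maps Y X. \<omega> ` {} \<subseteq> {}}" by blast
  then have "maps Y X \<in> ?G"
    by (intro CollectI exI[of _ "{}"] conjI) simp_all
  then show "maps Y X \<subseteq> topspace (compact_open_topology Y X)" unfolding * by blast
qed

lemma Sigma_rel_proj: "Sigma_rel k E p x y \<Longrightarrow> p (fst x) = p (fst y)"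
  unfolding Sigma_rel_def case_prod_unfold by (elim conjE)

lemma equivclp_Sigma_rel_proj:
  assumes "equivclp (Sigma_rel k E p) x y"
  shows "p (fst y) = p (fst x)"
  using assms
proof (induction rule: equivclp_induct)
  case (step y z)
  then show ?case by (metis Sigma_rel_proj)
qed (rule refl)

lemma Sigma_proj_class: "Sigma_proj p (Sigma_class k E p (e, t)) = p e"
proof -
  have "(e, t) \<in> Sigma_class k E p (e, t)" by (simp add: Sigma_class_def)
  then have "(SOME x. x \<in> Sigma_class k E p (e, t)) \<in> Sigma_class k E p (e, t)" by (rule someI)
  then show ?thesis
    unfolding Sigma_proj_def Sigma_class_def mem_Collect_eq
    by (metis equivclp_Sigma_rel_proj fst_conv)
qed

lemma Sigma_class_eqI:
  assumes "Sigma_rel k E p x y"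
  shows "Sigma_class k E p x = Sigma_class k E p y"
proof -
  have "equivclp (Sigma_rel k E p) x y" using assms by (rule r_into_equivclp)
  then show ?thesis
    unfolding Sigma_class_def by (intro Collect_cong) (metis equivclp_sym equivclp_trans)
qed

lemma Sigma_mu_eq:
  assumes e: "e \<in> topspace E" and t: "t \<in> cube_boundary k"
  shows "Sigma_mu k E p (p e) t = Sigma_class k E p (e, t)"
proof -
  define e' where "e' = (SOME e'. e' \<in> topspace E \<and> p e' = p e)"
  have "\<exists>e'. e' \<in> topspace E \<and> p e' = p e" using e by blast
  then have e': "e' \<in> topspace E \<and> p e' = p e" unfolding e'_def by (rule someI_ex)
  obtain i where "i \<in> {1..k}" "t i \<in> {0, 1}" and "t \<in> topspace (cube k)"
    using t unfolding cube_boundary_def by blast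
  with e e' have "Sigma_rel k E p (e', t) (e, t)"
    unfolding Sigma_rel_def prod.case by blast
  then show ?thesis unfolding Sigma_mu_def e'_def[symmetric] by (rule Sigma_class_eqI)
qed

text \<open>For \<open>k = 0\<close> the construction gives back \<open>p\<close>, up to the canonical homeomorphism.\<close>

lemma Q_space_0:
  fixes E :: "'e topology" and B :: "'b topology"
  assumes E: "k_space E" and p: "continuous_map E B p"
  shows "\<exists>h. homeomorphic_map E (Q_space 0 E B p) h \<and> (\<forall>e \<in> topspace E. Q_map 0 p (h e) = p e)"
proof -
  define u :: "nat \<Rightarrow> real" where "u = (\<lambda>_. undefined)"
  define S where "S = Sigma_space 0 E p"
  define M where "M = maps (cube 0) S"
  have cube: "topspace (cube 0) = {u}" by (simp add: cube_def u_def)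
  have orig: "cube_origin 0 = u" by (simp add: cube_origin_def u_def restrict_def)
  have bd: "cube_boundary 0 = {}" by (simp add: cube_boundary_def)
  have nrel: "\<not> Sigma_rel 0 E p x y" for x y by (auto simp: Sigma_rel_def)
  have cls: "Sigma_class 0 E p x = {x}" for x
  proof -
    have "equivclp (Sigma_rel 0 E p) x y \<Longrightarrow> y = x" for y
      by (induction rule: equivclp_induct) (auto simp: nrel)
    then show ?thesis unfolding Sigma_class_def by auto
  qed
  have prodt: "topspace (cg_prod E (cube 0)) = topspace E \<times> {u}"
    by (simp add: cg_prod_def cube)
  have St: "topspace S = (\<lambda>e. {(e, u)}) ` topspace E"
    by (auto simp: S_def Sigma_space_def prodt cls)
  have qm: "quotient_map (cg_prod E (cube 0)) S (Sigma_class 0 E p)"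
    unfolding S_def Sigma_space_def by (rule quotient_map_quotient_topology)
  have iS: "continuous_map E S (\<lambda>e. {(e, u)})"
  proof -
    have "continuous_map E (cg_prod E (cube 0)) (\<lambda>e. (e, u))"
      unfolding cg_prod_def
      using E by (simp add: continuous_map_into_kification continuous_map_pairwise o_def cube)
    then have "continuous_map E S (Sigma_class 0 E p \<circ> (\<lambda>e. (e, u)))"
      using qm quotient_imp_continuous_map continuous_map_compose by blast
    then show ?thesis by (simp add: o_def cls)
  qed
  have jS: "continuous_map S E (\<lambda>c. fst (the_elem c))"
  proof -
    have "continuous_map (cg_prod E (cube 0)) E ((\<lambda>c. fst (the_elem c)) \<circ> Sigma_class 0 E p)"
      unfolding cg_prod_def
      by (rule continuous_map_from_kification) (simp add: o_def cls continuous_map_fst)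
    then show ?thesis using qm by (simp add: continuous_compose_quotient_map_eq)
  qed
  define h where "h e = restrict (\<lambda>_. {(e, u)}) {u}" for e :: 'e
  have cont_const: "continuous_map (cube 0) S \<omega>" if "\<omega> u \<in> topspace S" for \<omega>
  proof -
    have "continuous_map (cube 0) S (\<lambda>_. \<omega> u)" using that by simp
    then show ?thesis by (rule continuous_map_eq) (simp add: cube)
  qed
  have hM: "h e \<in> M" if "e \<in> topspace E" for e
    using that unfolding M_def maps_def
    by (auto simp: cube h_def St intro!: cont_const)
  have Mh: "\<exists>e \<in> topspace E. \<omega> = h e" if \<omega>: "\<omega> \<in> M" for \<omega>
  proof -
    have "\<omega> u \<in> topspace S"
      using \<omega> cube unfolding M_def maps_def by (auto simp: continuous_map_def)
    then obtain e where e: "e \<in> topspace E" "\<omega> u = {(e, u)}" using St by auto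
    have "\<omega> = h e"
      using \<omega> e unfolding M_def maps_def h_def
      by (intro extensionalityI[of \<omega> "{u}"]) (auto simp: cube)
    with e show ?thesis by blast
  qed
  let ?Q = "{\<omega> \<in> maps (cube 0) S.
        \<exists>b \<in> topspace B. (\<forall>t \<in> topspace (cube 0). Sigma_proj p (\<omega> t) = b) \<and>
                        (\<forall>t \<in> cube_boundary 0. \<omega> t = Sigma_mu 0 E p b t)}"
  have projh: "Sigma_proj p (h e u) = p e" for e
    using Sigma_proj_class[of p 0 E e u] by (simp add: h_def cls)
  have "?Q = M"
  proof
    show "?Q \<subseteq> M" unfolding M_def by blast
    show "M \<subseteq> ?Q"
    proof
      fix \<omega> assume \<omega>: "\<omega> \<in> M"
      then obtain e where e: "e \<in> topspace E" "\<omega> = h e" using Mh by blast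
      have "p e \<in> topspace B" using p e by (auto simp: continuous_map_def)
      then show "\<omega> \<in> ?Q" using \<omega> e projh by (auto simp: M_def bd cube)
    qed
  qed
  moreover have "topspace (mapping_space (cube 0) S) = M" by (simp add: mapping_space_def M_def)
  ultimately have Q: "Q_space 0 E B p = kification (mapping_space (cube 0) S)"
    unfolding Q_space_def S_def[symmetric] cg_subspace_def by (metis subtopology_topspace)
  have Qt: "topspace (Q_space 0 E B p) = M" by (simp add: Q mapping_space_def M_def)
  have ch: "continuous_map E (Q_space 0 E B p) h"
    unfolding Q mapping_space_def kification_kification continuous_map_into_kification[OF E]
  proof -
    show "continuous_map E (compact_open_topology (cube 0) S) h"
      unfolding compact_open_topology_def
    proof (rule continuous_on_generated_topo)
      fix W assume "W \<in> {{\<omega> \<in> maps (cube 0) S. \<omega> ` K \<subseteq> U} |K U. compactin (cube 0) K \<and> openin S U}"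
      then obtain K U where W: "W = {\<omega> \<in> M. \<omega> ` K \<subseteq> U}" and K: "compactin (cube 0) K"
        and U: "openin S U" unfolding M_def by blast
      have "K \<subseteq> {u}" using K cube by (metis compactin_subset_topspace)
      then consider "K = {}" | "K = {u}" by blast
      then show "openin E (h -` W \<inter> topspace E)"
      proof cases
        case 1
        then have "h -` W \<inter> topspace E = topspace E" using hM by (auto simp: W)
        then show ?thesis by simp
      next
        case 2
        then have "h -` W \<inter> topspace E = {e \<in> topspace E. {(e, u)} \<in> U}"
          using hM by (auto simp: W h_def)
        then show ?thesis using openin_continuous_map_preimage[OF iS U] by simp
      qed
    next
      show "h ` topspace E \<subseteq> \<Union>{{\<omega> \<in> maps (cube 0) S. \<omega> ` K \<subseteq> U} |K U. compactin (cube 0) K \<and> openin S U}"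
        using hM topspace_compact_open_topology[of "cube 0" S]
        unfolding compact_open_topology_def topology_generated_by_topspace M_def by blast
    qed
  qed
  define j where "j \<omega> = fst (the_elem (\<omega> u))" for \<omega> :: "(nat \<Rightarrow> real) \<Rightarrow> ('e \<times> (nat \<Rightarrow> real)) set"
  have ev: "continuous_map (compact_open_topology (cube 0) S) S (\<lambda>\<omega>. \<omega> u)"
    unfolding continuous_map_def
  proof (intro conjI allI impI)
    show "(\<lambda>\<omega>. \<omega> u) \<in> topspace (compact_open_topology (cube 0) S) \<rightarrow> topspace S"
      by (auto simp: maps_def continuous_map_def cube)
    fix U assume U: "openin S U"
    have "compactin (cube 0) {u}" by (simp add: cube)
    moreover have "{\<omega> \<in> topspace (compact_open_topology (cube 0) S). \<omega> u \<in> U} =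
        {\<omega> \<in> maps (cube 0) S. \<omega> ` {u} \<subseteq> U}" by simp
    ultimately show "openin (compact_open_topology (cube 0) S)
        {\<omega> \<in> topspace (compact_open_topology (cube 0) S). \<omega> u \<in> U}"
      using U unfolding compact_open_topology_def by (intro topology_generated_by_Basis) blast
  qed
  have cj: "continuous_map (Q_space 0 E B p) E j"
  proof -
    have "continuous_map (compact_open_topology (cube 0) S) E j"
      using continuous_map_compose[OF ev jS] by (simp add: o_def j_def[abs_def])
    then show ?thesis unfolding Q mapping_space_def by (intro continuous_map_from_kification)
  qed
  have "homeomorphic_maps E (Q_space 0 E B p) h j"
    unfolding homeomorphic_maps_def
  proof (intro conjI ch cj ballI)
    show jh: "j (h e) = e" for e by (simp add: j_def h_def)
    show "h (j \<omega>) = \<omega>" if "\<omega> \<in> topspace (Q_space 0 E B p)" for \<omega>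
      using that Mh jh unfolding Qt by fastforce
  qed
  then have "homeomorphic_map E (Q_space 0 E B p) h" using homeomorphic_map_maps by blast
  moreover have "Q_map 0 p (h e) = p e" for e by (simp add: Q_map_def orig projh)
  ultimately show ?thesis by blast
qed

end

theory Submission
  imports Defs
begin

text \<open>
  Let \<open>n = Q\<^sup>k cat B\<close> and \<open>m = secat f\<close>.  As \<open>F\<close> has the homotopy type of a CW-complex, and
  CW-complexes are normal, bump functions turn a categorical cover for \<open>f\<close> into \<open>m + 1\<close> deformations
  of \<open>F\<close> such that every point is moved into \<open>f A\<close> by at least one of them.  Since \<open>b0\<close> is a
  neighbourhood deformation retract, these extend to deformations of \<open>E\<close>.  Lifting \<open>n + 1\<close> paths of
  \<open>B\<close> to \<open>E\<close> and prolonging each lift by the \<open>m + 1\<close> deformations gives a map over \<open>E\<close> from the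
  pullback of \<open>G\<^sub>n(* \<rightarrow> B)\<close> to \<open>G\<^sub>N(g)\<close>, where \<open>N + 1 = (n + 1) (m + 1)\<close>; applied fibrewise to
  \<open>\<Sigma>\<^sup>k\<close> it carries a section over \<open>B\<close> to one over \<open>E\<close>.  A section over \<open>B\<close> up to homotopy is
  enough, because that homotopy lifts to \<open>E\<close>.
\<close>

section \<open>Mapping spaces and lifting of homotopies\<close>

text \<open>For k > 0 the invariant of \<open>B\<close> is not described by open covers, so covers
  of \<open>B\<close> and \<open>F\<close> cannot simply be combined. A section of the
  \<open>Q\<close> construction is instead transported by one map acting on whole fibres. This is
  why the cover of \<open>F\<close> is traded for globally defined deformations: since they start at
  the identity they can prolong any path, and since the one that succeeds varies with the end point,
  all of them are recorded. The resulting map \<Phi> sends, for fixed \<open>x\<close> in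
  \<open>E\<close>, a whole fibre of the Ganea fibration over \<open>B\<close> into a single fibre
  over \<open>E\<close>. It therefore respects the identifications that define the fibrewise
  suspension. The obstacle is topological. \<Phi> exists only on a fibre product, the suspension is
  a quotient, and the product of a quotient map with an identity is again a quotient map when the
  other factor is locally compact. Continuity is therefore tested over compact subsets of
  \<open>E\<close>, which is enough for a k-space.\<close>

lemma continuous_map_curry:
  assumes "continuous_map (prod_topology X Y) Z (\<lambda>(x, y). h x y)"
  shows "continuous_map X (compact_open_topology Y Z) (\<lambda>x. restrict (h x) (topspace Y))"
proof -
  have maps: "restrict (h x) (topspace Y) \<in> maps Y Z" if "x \<in> topspace X" for x
  proof -
    have "continuous_map Y Z ((\<lambda>(x, y). h x y) \<circ> Pair x)"
      using assms that by (rule continuous_map_o_Pair)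
    then have "continuous_map Y Z (restrict (h x) (topspace Y))"
      by (rule continuous_map_eq) auto
    then show ?thesis by (simp add: maps_def)
  qed
  show ?thesis
    unfolding compact_open_topology_def
  proof (rule continuous_on_generated_topo)
    fix W assume "W \<in> {{\<omega> \<in> maps Y Z. \<omega> ` K \<subseteq> U} |K U. compactin Y K \<and> openin Z U}"
    then obtain K U where W: "W = {\<omega> \<in> maps Y Z. \<omega> ` K \<subseteq> U}" and K: "compactin Y K"
      and U: "openin Z U" by blast
    have KY: "K \<subseteq> topspace Y" using K compactin_subset_topspace by blast
    let ?V = "{z \<in> topspace (prod_topology X Y). (\<lambda>(x, y). h x y) z \<in> U}"
    have V: "openin (prod_topology X Y) ?V"
      using assms U by (rule openin_continuous_map_preimage)
    have eq: "(\<lambda>x. restrict (h x) (topspace Y)) -` W \<inter> topspace X =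
        {x \<in> topspace X. \<forall>y\<in>K. h x y \<in> U}"
      using maps KY by (auto simp: W image_subset_iff)
    show "openin X ((\<lambda>x. restrict (h x) (topspace Y)) -` W \<inter> topspace X)"
      unfolding eq
    proof (subst openin_subopen, clarify)
      fix x assume x: "x \<in> topspace X" "\<forall>y\<in>K. h x y \<in> U"
      then have "{x} \<times> K \<subseteq> ?V" using KY by auto
      \<comment> \<open>Compactness of \<open>K\<close> enters through the tube lemma: some
        neighbourhood \<open>A\<close> of \<open>x\<close> has all of \<open>A \<times> K\<close> in
        the preimage of \<open>U\<close>.\<close>
      then obtain A B where "openin X A" "x \<in> A" "K \<subseteq> B" "A \<times> B \<subseteq> ?V"
        using tube_lemma_right[OF V K x(1)] by blast
      then show "\<exists>T. openin X T \<and> x \<in> T \<and> T \<subseteq> {x \<in> topspace X. \<forall>y\<in>K. h x y \<in> U}"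
        proof (intro exI[of _ A] conjI subsetI CollectI ballI)
        fix x' y assume "x' \<in> A" "y \<in> K"
        then have "(x', y) \<in> ?V" using \<open>K \<subseteq> B\<close> \<open>A \<times> B \<subseteq> ?V\<close> by blast
        then show "h x' y \<in> U" by simp
      qed (use \<open>openin X A\<close> openin_subset in blast)+
    qed
  next
    show "(\<lambda>x. restrict (h x) (topspace Y)) ` topspace X \<subseteq>
        \<Union>{{\<omega> \<in> maps Y Z. \<omega> ` K \<subseteq> U} |K U. compactin Y K \<and> openin Z U}"
      using maps topspace_compact_open_topology[of Y Z]
      unfolding compact_open_topology_def topology_generated_by_topspace by blast
  qed
qed

lemma openin_compact_open:
  assumes "compactin Y K" "openin Z U"
  shows "openin (compact_open_topology Y Z) {\<omega> \<in> maps Y Z. \<omega> ` K \<subseteq> U}"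
  unfolding compact_open_topology_def using assms by (intro topology_generated_by_Basis) blast

text \<open>If \<omega> y lies in \<open>U\<close>, local compactness gives a compact neighbourhood
  \<open>K\<close> of \<open>y\<close> that \<omega> sends into \<open>U\<close>. The maps sending
  \<open>K\<close> into \<open>U\<close>, times an open \<open>N\<close> between \<open>y\<close>
  and \<open>K\<close>, form the required neighbourhood.\<close>

lemma continuous_map_eval:
  assumes Y: "locally_compact_space Y" "Hausdorff_space Y"
  shows "continuous_map (prod_topology (compact_open_topology Y Z) Y) Z (\<lambda>(\<omega>, y). \<omega> y)"
  unfolding continuous_map
proof (intro conjI allI impI)
  show "(\<lambda>(\<omega>, y). \<omega> y) ` topspace (prod_topology (compact_open_topology Y Z) Y) \<subseteq> topspace Z"
    by (auto simp: maps_def continuous_map_def)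
  fix U assume U: "openin Z U"
  show "openin (prod_topology (compact_open_topology Y Z) Y)
      {x \<in> topspace (prod_topology (compact_open_topology Y Z) Y). (case x of (\<omega>, y) \<Rightarrow> \<omega> y) \<in> U}"
  proof (subst openin_subopen, clarify, goal_cases)
    case (1 \<omega> y)
    then have \<omega>: "\<omega> \<in> maps Y Z" and y: "y \<in> topspace Y" "\<omega> y \<in> U" by auto
    then have "openin Y {y \<in> topspace Y. \<omega> y \<in> U}"
      using U by (auto simp: maps_def intro: openin_continuous_map_preimage)
    with y obtain N K where N: "openin Y N" "compactin Y K" "y \<in> N" "N \<subseteq> K"
      and K: "K \<subseteq> {y \<in> topspace Y. \<omega> y \<in> U}"
      using neighbourhood_base_of[THEN iffD1, rule_format, of "compactin Y" Y "{y \<in> topspace Y. \<omega> y \<in> U}" y]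
        Y locally_compact_space_neighbourhood_base[of Y] by auto
    let ?W = "{\<omega> \<in> maps Y Z. \<omega> ` K \<subseteq> U}"
    have "openin (prod_topology (compact_open_topology Y Z) Y) (?W \<times> N)"
      using N U by (intro openin_prod_Times_iff[THEN iffD2]) (auto intro: openin_compact_open)
    moreover have "(\<omega>, y) \<in> ?W \<times> N" using \<omega> N K by auto
    moreover have "?W \<times> N \<subseteq> {x \<in> topspace (prod_topology (compact_open_topology Y Z) Y).
        (case x of (\<omega>, y) \<Rightarrow> \<omega> y) \<in> U}"
      using N openin_subset[OF N(1)] by auto
    ultimately show ?case by blast
  qed
qed

lemma continuous_map_uncurry:
  assumes "locally_compact_space Y" "Hausdorff_space Y"
    and "continuous_map X (compact_open_topology Y Z) h"
  shows "continuous_map (prod_topology X Y) Z (\<lambda>(x, y). h x y)"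
proof -
  have "continuous_map (prod_topology X Y) (prod_topology (compact_open_topology Y Z) Y)
      (\<lambda>(x, y). (h x, y))"
    unfolding continuous_map_pairwise
    using continuous_map_compose[OF continuous_map_fst assms(3), of Y] continuous_map_snd[of X Y]
    by (simp add: o_def case_prod_unfold)
  from continuous_map_compose[OF this continuous_map_eval[OF assms(1,2)]] show ?thesis
    by (simp add: o_def case_prod_unfold)
qed

lemma continuous_map_swap: "continuous_map (prod_topology X Y) (prod_topology Y X) (\<lambda>(x, y). (y, x))"
  unfolding continuous_map_pairwise
  using continuous_map_fst[of X Y] continuous_map_snd[of X Y]
  by (simp add: o_def case_prod_unfold)

lemma continuous_map_kification_id: "continuous_map (kification X) X id"
  by (simp add: continuous_map_from_kification)

lemma Hausdorff_space_kification:
  assumes "Hausdorff_space X" shows "Hausdorff_space (kification X)"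
  using assms unfolding Hausdorff_space_def
  by (metis openin_kification_finer topspace_kification)

lemma Hausdorff_space_compact_open:
  assumes "Hausdorff_space Z" shows "Hausdorff_space (compact_open_topology Y Z)"
  unfolding Hausdorff_space_def
proof (intro allI impI, elim conjE)
  fix \<omega> \<eta> assume *: "\<omega> \<in> topspace (compact_open_topology Y Z)" "\<eta> \<in> topspace (compact_open_topology Y Z)" "\<omega> \<noteq> \<eta>"
  then have m: "\<omega> \<in> maps Y Z" "\<eta> \<in> maps Y Z" by auto
  then obtain y where y: "y \<in> topspace Y" "\<omega> y \<noteq> \<eta> y"
    using *(3) unfolding maps_def by (metis (no_types, lifting) extensionalityI mem_Collect_eq)
  moreover have "\<omega> y \<in> topspace Z" "\<eta> y \<in> topspace Z"
    using m y by (auto simp: maps_def continuous_map_def)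
  ultimately obtain U V where "openin Z U" "openin Z V" "\<omega> y \<in> U" "\<eta> y \<in> V" "disjnt U V"
    using assms unfolding Hausdorff_space_def by metis
  then show "\<exists>U V. openin (compact_open_topology Y Z) U \<and> openin (compact_open_topology Y Z) V \<and>
      \<omega> \<in> U \<and> \<eta> \<in> V \<and> disjnt U V"
    using m y
    by (intro exI[of _ "{\<omega> \<in> maps Y Z. \<omega> ` {y} \<subseteq> U}"] exI[of _ "{\<omega> \<in> maps Y Z. \<omega> ` {y} \<subseteq> V}"]
        conjI openin_compact_open) (auto simp: disjnt_iff)
qed

lemma unit_interval_compact: "compact_space unit_interval" "Hausdorff_space unit_interval"
  "locally_compact_space unit_interval"
proof -
  show "compact_space unit_interval"
    by (simp add: compact_space_subtopology)
  then show "locally_compact_space unit_interval" by (rule compact_imp_locally_compact_space)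
  show "Hausdorff_space unit_interval" by (simp add: Hausdorff_space_subtopology)
qed

text \<open>\<open>fibration\<close> speaks of test spaces of one type, whereas \<open>X\<close> has
  any type. The space \<open>Z\<close> of pairs (e, \<gamma>) with \<gamma> 0 = p e is universal:
  its evaluation homotopy is lifted once, to \<open>L\<close>, and every other lifting problem is
  pulled back from it along \<open>c\<close>, which pairs the initial map with the tracks of the
  homotopy.\<close>

lemma fibration_lift:
  fixes E :: "'e topology" and B :: "'b topology" and X :: "'x topology"
  assumes fib: "fibration E B p" and E: "Hausdorff_space E" and B: "Hausdorff_space B"
    and X: "k_space X" and h: "continuous_map X E h"
    and H: "continuous_map (prod_topology unit_interval X) B H"
    and H0: "\<And>x. x \<in> topspace X \<Longrightarrow> H (0, x) = p (h x)"
  shows "\<exists>K. continuous_map (prod_topology unit_interval X) E K \<and>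
          (\<forall>x \<in> topspace X. K (0, x) = h x) \<and>
          (\<forall>t \<in> {0..1}. \<forall>x \<in> topspace X. p (K (t, x)) = H (t, x))"
proof -
  let ?M = "compact_open_topology unit_interval B"
  define S where "S = {(e, \<gamma>). e \<in> topspace E \<and> \<gamma> \<in> maps unit_interval B \<and> \<gamma> 0 = p e}"
  \<comment> \<open>The k-ification makes \<open>Z\<close> an admissible test space; maps from the
    k-space \<open>X\<close> into it remain continuous.\<close>
  define Z where "Z = kification (subtopology (prod_topology E ?M) S)"
  have Zt: "topspace Z = S" by (auto simp: Z_def S_def)
  have Zid: "continuous_map Z (prod_topology E ?M) id"
    unfolding Z_def by (intro continuous_map_from_kification continuous_map_id_subt[unfolded id_def[symmetric]])
  have "cg_hausdorff Z"
    unfolding cg_hausdorff_def Z_def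
    by (intro conjI k_space_kification Hausdorff_space_kification Hausdorff_space_subtopology)
      (simp add: Hausdorff_space_prod_topology E B Hausdorff_space_compact_open)
  moreover have Zf: "continuous_map Z E fst"
    using continuous_map_compose[OF Zid continuous_map_fst] by (simp add: o_def)
  moreover have "continuous_map (prod_topology unit_interval Z) B (\<lambda>(t, e, \<gamma>). \<gamma> t)"
  proof -
    have "continuous_map Z ?M snd"
      using continuous_map_compose[OF Zid continuous_map_snd] by (simp add: o_def)
    then have "continuous_map (prod_topology Z unit_interval) B (\<lambda>(z, t). snd z t)"
      by (intro continuous_map_uncurry unit_interval_compact)
    from continuous_map_compose[OF continuous_map_swap this] show ?thesis
      by (simp add: o_def case_prod_unfold)
  qed
  moreover have "\<forall>z \<in> topspace Z. (\<lambda>(t, e, \<gamma>). \<gamma> t) (0, z) = p (fst z)"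
    by (auto simp: Zt S_def)
  ultimately obtain L where L: "continuous_map (prod_topology unit_interval Z) E L"
    "\<forall>z \<in> topspace Z. L (0, z) = fst z"
    "\<forall>t \<in> {0..1}. \<forall>z \<in> topspace Z. p (L (t, z)) = (\<lambda>(t, e, \<gamma>). \<gamma> t) (t, z)"
    using fib unfolding fibration_def by blast
  define c where "c x = (h x, restrict (\<lambda>t. H (t, x)) {0..1})" for x
  have cc: "continuous_map X ?M (\<lambda>x. restrict (\<lambda>t. H (t, x)) {0..1})"
  proof -
    have "continuous_map (prod_topology X unit_interval) B (\<lambda>(x, t). H (t, x))"
      using continuous_map_compose[OF continuous_map_swap H] by (simp add: o_def case_prod_unfold)
    then show ?thesis using continuous_map_curry[of X unit_interval B "\<lambda>x t. H (t, x)"] by simp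
  qed
  have cS: "c x \<in> S" if "x \<in> topspace X" for x
    using that cc h H0 by (auto simp: c_def S_def continuous_map_def)
  have c: "continuous_map X Z c"
    unfolding Z_def continuous_map_into_kification[OF X] continuous_map_in_subtopology
    using cS cc h by (auto simp: continuous_map_pairwise c_def o_def)
  have "continuous_map (prod_topology unit_interval X) (prod_topology unit_interval Z) (\<lambda>(t, x). (t, c x))"
    unfolding continuous_map_pairwise
    using continuous_map_compose[OF continuous_map_snd c, of unit_interval] continuous_map_fst[of unit_interval X]
    by (simp add: o_def case_prod_unfold)
  from continuous_map_compose[OF this L(1)]
  have "continuous_map (prod_topology unit_interval X) E (\<lambda>(t, x). L (t, c x))"
    by (simp add: o_def case_prod_unfold)
  then show ?thesis
    using L(2,3) cS by (intro exI[of _ "\<lambda>(t, x). L (t, c x)"]) (auto simp: Zt c_def)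
qed

section \<open>Functoriality of the fibrewise \<open>Q\<close> construction\<close>

lemma continuous_map_into_cg_subspace:
  assumes "k_space X"
  shows "continuous_map X (cg_subspace Y S) f \<longleftrightarrow> continuous_map X Y f \<and> f \<in> topspace X \<rightarrow> S"
  unfolding cg_subspace_def continuous_map_into_kification[OF assms] continuous_map_in_subtopology
  by blast

lemma continuous_map_from_cg_subspace: "continuous_map (cg_subspace Y S) Y id"
  unfolding cg_subspace_def
  by (intro continuous_map_from_kification) (simp add: continuous_map_from_subtopology)

lemma continuous_map_into_mapping_space:
  assumes "k_space X"
  shows "continuous_map X (mapping_space Y Z) f \<longleftrightarrow> continuous_map X (compact_open_topology Y Z) f"
  unfolding mapping_space_def by (rule continuous_map_into_kification[OF assms])

lemma cube_compact: "compact_space (cube k)" "Hausdorff_space (cube k)" "locally_compact_space (cube k)"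
proof -
  show "compact_space (cube k)"
    unfolding cube_def using unit_interval_compact(1) by (simp add: compact_space_product_topology)
  then show "locally_compact_space (cube k)" by (rule compact_imp_locally_compact_space)
  show "Hausdorff_space (cube k)"
    unfolding cube_def using unit_interval_compact(2) by (simp add: Hausdorff_space_product_topology)
qed

lemma cube_origin_in: "cube_origin k \<in> topspace (cube k)"
  by (auto simp: cube_origin_def cube_def)

lemma quotient_map_Sigma_class:
  "quotient_map (cg_prod G (cube k)) (Sigma_space k G p) (Sigma_class k G p)"
  unfolding Sigma_space_def by (rule quotient_map_quotient_topology)

lemma topspace_Sigma_space:
  "topspace (Sigma_space k G p) = Sigma_class k G p ` (topspace G \<times> topspace (cube k))"
  by (simp add: Sigma_space_def cg_prod_def)

lemma continuous_map_Sigma_proj: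
  assumes "continuous_map G B p"
  shows "continuous_map (Sigma_space k G p) B (Sigma_proj p)"
proof (rule continuous_compose_quotient_map[OF quotient_map_Sigma_class])
  have "continuous_map (prod_topology G (cube k)) B (p \<circ> fst)"
    using continuous_map_compose[OF continuous_map_fst assms] .
  moreover have "Sigma_proj p \<circ> Sigma_class k G p = p \<circ> fst"
    by (auto simp: fun_eq_iff Sigma_proj_class)
  ultimately show "continuous_map (cg_prod G (cube k)) B (Sigma_proj p \<circ> Sigma_class k G p)"
    unfolding cg_prod_def by (metis continuous_map_from_kification)
qed

lemma Q_space_D:
  assumes "\<omega> \<in> topspace (Q_space k G B p)"
  shows "\<omega> \<in> maps (cube k) (Sigma_space k G p)"
    and "Q_map k p \<omega> \<in> topspace B"
    and "t \<in> topspace (cube k) \<Longrightarrow> Sigma_proj p (\<omega> t) = Q_map k p \<omega>"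
    and "t \<in> cube_boundary k \<Longrightarrow> \<omega> t = Sigma_mu k G p (Q_map k p \<omega>) t"
proof -
  have "\<omega> \<in> maps (cube k) (Sigma_space k G p) \<and> (\<exists>b \<in> topspace B.
     (\<forall>t \<in> topspace (cube k). Sigma_proj p (\<omega> t) = b) \<and> (\<forall>t \<in> cube_boundary k. \<omega> t = Sigma_mu k G p b t))"
    using assms unfolding Q_space_def cg_subspace_def by simp
  then show "\<omega> \<in> maps (cube k) (Sigma_space k G p)" "Q_map k p \<omega> \<in> topspace B"
    "t \<in> topspace (cube k) \<Longrightarrow> Sigma_proj p (\<omega> t) = Q_map k p \<omega>"
    "t \<in> cube_boundary k \<Longrightarrow> \<omega> t = Sigma_mu k G p (Q_map k p \<omega>) t"
    unfolding Q_map_def using cube_origin_in by auto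
qed

lemma continuous_map_Q_space_compact_open:
  "continuous_map (Q_space k G B p) (compact_open_topology (cube k) (Sigma_space k G p)) id"
proof -
  have "continuous_map (kification (compact_open_topology (cube k) (Sigma_space k G p)))
      (compact_open_topology (cube k) (Sigma_space k G p)) id"
    by (rule continuous_map_kification_id)
  from continuous_map_compose[OF continuous_map_from_cg_subspace this] show ?thesis
    unfolding Q_space_def mapping_space_def by simp
qed

definition fibre_product :: "'x topology \<Rightarrow> 'g topology \<Rightarrow> ('x \<Rightarrow> 'b) \<Rightarrow> ('g \<Rightarrow> 'b) \<Rightarrow> ('x \<times> 'g) topology"
  where "fibre_product X G r p = cg_subspace (prod_topology X G) {(x, g). r x = p g}"

text \<open>The action of \<psi> on classes goes through an arbitrary representative, so it is
  meaningful only over points whose whole fibre is carried into one fibre of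
  \<open>p'\<close>.\<close>

definition Sigma_map :: "nat \<Rightarrow> 'h topology \<Rightarrow> ('h \<Rightarrow> 'c) \<Rightarrow> ('g \<Rightarrow> 'h) \<Rightarrow>
    ('g \<times> (nat \<Rightarrow> real)) set \<Rightarrow> ('h \<times> (nat \<Rightarrow> real)) set" where
  "Sigma_map k G' p' \<psi> c = Sigma_class k G' p' (map_prod \<psi> id (SOME z. z \<in> c))"

text \<open>A generating relation stays over one point of the base, so a chain starting at
  \<open>(g, t)\<close> never leaves the fibre through \<open>g\<close>, and control of \<psi> on
  that fibre suffices. This matters because \<psi> will be \<Phi> (x, -), which is controlled only
  over r x.\<close>

lemma Sigma_map_class:
  assumes \<psi>: "\<And>g'. g' \<in> topspace G \<Longrightarrow> p g' = p g \<Longrightarrow> \<psi> g' \<in> topspace G' \<and> p' (\<psi> g') = b"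
  shows "Sigma_map k G' p' \<psi> (Sigma_class k G p (g, t)) = Sigma_class k G' p' (\<psi> g, t)"
proof -
  have rel: "Sigma_class k G' p' (map_prod \<psi> id y) = Sigma_class k G' p' (map_prod \<psi> id z)"
    if "Sigma_rel k G p y z" "p (fst y) = p g" for y z
  proof (rule Sigma_class_eqI)
    have "p (fst z) = p g" using that Sigma_rel_proj by metis
    with that show "Sigma_rel k G' p' (map_prod \<psi> id y) (map_prod \<psi> id z)"
      using \<psi>[of "fst y"] \<psi>[of "fst z"] unfolding Sigma_rel_def case_prod_unfold by simp
  qed
  have inv: "p (fst z) = p g \<and>
      Sigma_class k G' p' (map_prod \<psi> id z) = Sigma_class k G' p' (\<psi> g, t)"
    if "equivclp (Sigma_rel k G p) (g, t) z" for z
    using that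
  proof (induction rule: equivclp_induct)
    case (step y z)
    then show ?case using rel[of y z] rel[of z y] Sigma_rel_proj[of k G p] by metis
  qed simp
  have "(g, t) \<in> Sigma_class k G p (g, t)" by (simp add: Sigma_class_def)
  then have "(SOME z. z \<in> Sigma_class k G p (g, t)) \<in> Sigma_class k G p (g, t)" by (rule someI)
  then show ?thesis
    using inv unfolding Sigma_map_def Sigma_class_def[of k G p] mem_Collect_eq by blast
qed

text \<open>Over a point \<open>x\<close>, the map \<Phi> (x, -) induces \<open>T x\<close> from the
  fibre of the suspension over r x to the one over \<rho> x, and \<sigma> x is the cube s x followed
  by \<open>T x\<close>. Boundary values survive because \<open>T x\<close> leaves the cube
  coordinate alone. The work lies in the joint continuity of \<open>T\<close>.\<close>

lemma Q_section_transfer: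
  fixes X :: "'x topology" and G :: "'g topology" and G' :: "'h topology"
    and B :: "'b topology" and E :: "'c topology"
  assumes X: "k_space X" "Hausdorff_space X" and G: "k_space G" and B: "Hausdorff_space B"
    and p: "continuous_map G B p" and r: "continuous_map X B r"
    and s: "continuous_map X (Q_space k G B p) s"
    and sr: "\<And>x. x \<in> topspace X \<Longrightarrow> Q_map k p (s x) = r x"
    and \<Phi>: "continuous_map (fibre_product X G r p) G' \<Phi>"
    and p': "\<And>x g. x \<in> topspace X \<Longrightarrow> g \<in> topspace G \<Longrightarrow> r x = p g \<Longrightarrow> p' (\<Phi> (x, g)) = \<rho> x"
    and \<rho>: "\<rho> \<in> topspace X \<rightarrow> topspace E"
  shows "\<exists>\<sigma>. continuous_map X (Q_space k G' E p') \<sigma> \<and>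
    (\<forall>x \<in> topspace X. Q_map k p' (\<sigma> x) = \<rho> x)"
proof -
  let ?S = "Sigma_space k G p" and ?S' = "Sigma_space k G' p'"
  define T where "T x c = Sigma_map k G' p' (\<lambda>g. \<Phi> (x, g)) c" for x c
  have FP: "topspace (fibre_product X G r p) = {(x, g). x \<in> topspace X \<and> g \<in> topspace G \<and> r x = p g}"
    by (auto simp: fibre_product_def cg_subspace_def)
  have \<Phi>G: "\<Phi> (x, g) \<in> topspace G'" if "x \<in> topspace X" "g \<in> topspace G" "r x = p g" for x g
    using \<Phi> that FP unfolding continuous_map_def by blast
  have T: "T x (Sigma_class k G p (g, t)) = Sigma_class k G' p' (\<Phi> (x, g), t)"
    if "x \<in> topspace X" "r x = p g" for x g t
    unfolding T_def by (rule Sigma_map_class[where b = "\<rho> x"]) (use that p' \<Phi>G in auto)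
  have sQ: "s x \<in> topspace (Q_space k G B p)" if "x \<in> topspace X" for x
    using s that by (auto simp: continuous_map_def)
  have sS: "s x t \<in> topspace ?S" if "x \<in> topspace X" "t \<in> topspace (cube k)" for x t
    using Q_space_D(1)[OF sQ[OF that(1)]] that(2) by (auto simp: maps_def continuous_map_def)
  have sx: "\<exists>g \<in> topspace G. \<exists>t' \<in> topspace (cube k). r x = p g \<and> s x t = Sigma_class k G p (g, t')"
    if x: "x \<in> topspace X" and t: "t \<in> topspace (cube k)" for x t
  proof -
    obtain g t' where *: "g \<in> topspace G" "t' \<in> topspace (cube k)" "s x t = Sigma_class k G p (g, t')"
      using sS[OF x t] by (auto simp: topspace_Sigma_space)
    with Q_space_D(3)[OF sQ[OF x] t] sr[OF x] have "r x = p g" by (simp add: Sigma_proj_class)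
    with * show ?thesis by blast
  qed
  have proj: "continuous_map ?S B (Sigma_proj p)" by (rule continuous_map_Sigma_proj[OF p])
  have s_co: "continuous_map X (compact_open_topology (cube k) ?S) s"
    using continuous_map_compose[OF s continuous_map_Q_space_compact_open] by simp
  define \<sigma> where "\<sigma> x = restrict (\<lambda>t. T x (s x t)) (topspace (cube k))" for x
  have \<sigma>_co: "continuous_map X (compact_open_topology (cube k) ?S') \<sigma>"
  \<comment> \<open>A compact Hausdorff \<open>K\<close> is locally compact, so its product with the
    quotient map onto the suspension is again a quotient map.\<close>
  proof (rule continuous_map_from_k_space[OF X(1)])
    fix K assume K: "compactin X K"
    let ?K = "subtopology X K"
    have Kc: "locally_compact_space ?K" "Hausdorff_space ?K"
      using K X(2) by (simp_all add: compact_imp_locally_compact_space compact_space_subtopology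
          Hausdorff_space_subtopology)
    have Kid: "continuous_map ?K X id" by (simp add: continuous_map_from_subtopology)
    have sev: "continuous_map (prod_topology ?K (cube k)) ?S (\<lambda>(x, t). s x t)"
      using continuous_map_compose[OF Kid s_co]
      by (intro continuous_map_uncurry cube_compact) simp
    \<comment> \<open>\<open>V\<close> is the fibre product of \<open>K\<close> with the suspension
      over \<open>B\<close>, where \<open>T\<close> is meaningful. It is closed because
      \<open>B\<close> is Hausdorff; hence the quotient map restricts to a quotient map onto
      \<open>V\<close>, and the preimage \<open>U\<close> is a k-space, as is required for mapping
      it into k-ified products.\<close>
    define V where "V = {z \<in> topspace (prod_topology ?K ?S). r (fst z) = Sigma_proj p (snd z)}"
    have rK: "continuous_map (prod_topology ?K Y) B (\<lambda>z. r (fst z))" for Y :: "'y topology"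
      using continuous_map_compose[OF continuous_map_fst continuous_map_compose[OF Kid r]]
      by (simp add: o_def)
    have V: "closedin (prod_topology ?K ?S) V"
      unfolding V_def
      by (rule closedin_continuous_maps_eq[OF B rK])
        (use continuous_map_compose[OF continuous_map_snd proj] in \<open>simp add: o_def\<close>)
    let ?q = "\<lambda>(x, y). (x, Sigma_class k G p y)"
    let ?PG = "prod_topology ?K (cg_prod G (cube k))"
    have q: "quotient_map ?PG (prod_topology ?K ?S) ?q"
      using quotient_map_prod_right[OF Kc(1) _ quotient_map_Sigma_class] Kc by blast
    define U where "U = {z \<in> topspace ?PG. ?q z \<in> V}"
    have qU: "quotient_map (subtopology ?PG U) (subtopology (prod_topology ?K ?S) V) ?q"
      by (rule quotient_map_restriction[OF q]) (auto simp: U_def V)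
    have "k_space ?PG"
      by (rule k_space_prod_topology_left) (use Kc in \<open>simp_all add: cg_prod_def\<close>)
    moreover have "closedin ?PG U"
      unfolding U_def using closedin_continuous_map_preimage[OF quotient_imp_continuous_map[OF q] V] .
    ultimately have kU: "k_space (subtopology ?PG U)" by (rule k_space_closed_subtopology)
    have Uid: "continuous_map (subtopology ?PG U) (prod_topology ?K (prod_topology G (cube k))) id"
    proof -
      have "continuous_map ?PG (prod_topology ?K (prod_topology G (cube k))) id"
        unfolding continuous_map_pairwise
        using continuous_map_fst[of ?K "cg_prod G (cube k)"]
          continuous_map_compose[OF continuous_map_snd[of ?K "cg_prod G (cube k)"]
            continuous_map_kification_id[of "prod_topology G (cube k)", folded cg_prod_def]]
        by (simp add: o_def continuous_map_pairwise)
      then show ?thesis by (rule continuous_map_from_subtopology)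
    qed
    have U1: "continuous_map (subtopology ?PG U) X (\<lambda>z. fst z)"
      using continuous_map_compose[OF continuous_map_compose[OF Uid continuous_map_fst] Kid]
      by (simp add: o_def)
    have U2: "continuous_map (subtopology ?PG U) G (\<lambda>z. fst (snd z))"
      using continuous_map_compose[OF continuous_map_compose[OF Uid continuous_map_snd] continuous_map_fst]
      by (simp add: o_def)
    have U3: "continuous_map (subtopology ?PG U) (cube k) (\<lambda>z. snd (snd z))"
      using continuous_map_compose[OF continuous_map_compose[OF Uid continuous_map_snd] continuous_map_snd]
      by (simp add: o_def)
    have Ur: "r (fst z) = p (fst (snd z))" if "z \<in> topspace (subtopology ?PG U)" for z
      using that by (auto simp: U_def V_def Sigma_proj_class)
    have "continuous_map (subtopology ?PG U) (fibre_product X G r p) (\<lambda>z. (fst z, fst (snd z)))"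
      unfolding fibre_product_def continuous_map_into_cg_subspace[OF kU]
      using U1 U2 Ur by (auto simp: continuous_map_pairwise o_def)
    from continuous_map_compose[OF this \<Phi>]
    have "continuous_map (subtopology ?PG U) (prod_topology G' (cube k))
        (\<lambda>z. (\<Phi> (fst z, fst (snd z)), snd (snd z)))"
      using U3 by (simp add: continuous_map_pairwise o_def)
    then have "continuous_map (subtopology ?PG U) (cg_prod G' (cube k))
        (\<lambda>z. (\<Phi> (fst z, fst (snd z)), snd (snd z)))"
      by (simp add: cg_prod_def[of G'] continuous_map_into_kification[OF kU])
    from continuous_map_compose[OF this quotient_imp_continuous_map[OF quotient_map_Sigma_class]]
    have "continuous_map (subtopology ?PG U) ?S'
        (\<lambda>z. Sigma_class k G' p' (\<Phi> (fst z, fst (snd z)), snd (snd z)))"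
      by (simp add: o_def)
    then have "continuous_map (subtopology ?PG U) ?S' ((\<lambda>(x, c). T x c) \<circ> ?q)"
    proof (rule continuous_map_eq)
      fix z assume z: "z \<in> topspace (subtopology ?PG U)"
      have "fst z \<in> topspace X" using z by auto
      then show "Sigma_class k G' p' (\<Phi> (fst z, fst (snd z)), snd (snd z)) = ((\<lambda>(x, c). T x c) \<circ> ?q) z"
        using T[of "fst z" "fst (snd z)" "snd (snd z)"] Ur[OF z] by (simp add: case_prod_unfold)
    qed
    then have TV: "continuous_map (subtopology (prod_topology ?K ?S) V) ?S' (\<lambda>(x, c). T x c)"
      by (rule continuous_compose_quotient_map[OF qU])
    have "continuous_map (prod_topology ?K (cube k)) (subtopology (prod_topology ?K ?S) V)
        (\<lambda>(x, t). (x, s x t))"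
      unfolding continuous_map_in_subtopology
    proof
      show "continuous_map (prod_topology ?K (cube k)) (prod_topology ?K ?S) (\<lambda>(x, t). (x, s x t))"
        using sev continuous_map_fst[of ?K "cube k"]
        by (simp add: continuous_map_pairwise o_def case_prod_unfold)
      show "(\<lambda>(x, t). (x, s x t)) \<in> topspace (prod_topology ?K (cube k)) \<rightarrow> V"
        using Q_space_D(3)[OF sQ] sr sS by (auto simp: V_def)
    qed
    from continuous_map_compose[OF this TV]
    have "continuous_map (prod_topology ?K (cube k)) ?S' (\<lambda>(x, t). T x (s x t))"
      by (simp add: o_def case_prod_unfold)
    then show "continuous_map ?K (compact_open_topology (cube k) ?S') \<sigma>"
      unfolding \<sigma>_def[abs_def] by (rule continuous_map_curry)
  qed
  have \<sigma>m: "\<sigma> x \<in> maps (cube k) ?S'" if "x \<in> topspace X" for x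
    using \<sigma>_co that by (auto simp: continuous_map_def)
  have \<sigma>p: "Sigma_proj p' (\<sigma> x t) = \<rho> x" if x: "x \<in> topspace X" and t: "t \<in> topspace (cube k)" for x t
    using sx[OF x t] T[OF x] p'[OF x] t by (auto simp: \<sigma>_def Sigma_proj_class)
  have \<sigma>b: "\<sigma> x t = Sigma_mu k G' p' (\<rho> x) t" if x: "x \<in> topspace X" and t: "t \<in> cube_boundary k" for x t
  proof -
    have tc: "t \<in> topspace (cube k)" using t by (simp add: cube_boundary_def)
    \<comment> \<open>The representative supplied by \<open>sx\<close> may have a cube coordinate
      other than \<open>t\<close>, so only its point \<open>g\<close> is kept. On the boundary, any
      point over r x represents the class at \<open>t\<close>.\<close>
    obtain g where g: "g \<in> topspace G" "r x = p g" using sx[OF x tc] by blast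
    have "s x t = Sigma_class k G p (g, t)"
      using Q_space_D(4)[OF sQ[OF x] t] sr[OF x] g Sigma_mu_eq[OF g(1) t] by metis
    then have "\<sigma> x t = Sigma_class k G' p' (\<Phi> (x, g), t)"
      using T[OF x g(2)] tc by (simp add: \<sigma>_def)
    also have "\<dots> = Sigma_mu k G' p' (p' (\<Phi> (x, g))) t"
      using Sigma_mu_eq[OF \<Phi>G[OF x g] t] by metis
    finally show ?thesis using p'[OF x g] by simp
  qed
  have "continuous_map X (Q_space k G' E p') \<sigma>"
    unfolding Q_space_def continuous_map_into_cg_subspace[OF X(1)] continuous_map_into_mapping_space[OF X(1)]
  proof (intro conjI \<sigma>_co funcsetI CollectI)
    fix x assume x: "x \<in> topspace X"
    show "\<sigma> x \<in> maps (cube k) ?S'" by (rule \<sigma>m[OF x])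
    show "\<exists>b\<in>topspace E. (\<forall>t\<in>topspace (cube k). Sigma_proj p' (\<sigma> x t) = b) \<and>
        (\<forall>t\<in>cube_boundary k. \<sigma> x t = Sigma_mu k G' p' b t)"
      using \<rho> x \<sigma>p[OF x] \<sigma>b[OF x] by blast
  qed
  moreover have "Q_map k p' (\<sigma> x) = \<rho> x" if "x \<in> topspace X" for x
    unfolding Q_map_def using \<sigma>p[OF that cube_origin_in] .
  ultimately show ?thesis by blast
qed

section \<open>Normality of CW-complexes\<close>

lemma topspace_unit_disc: "topspace (unit_disc n) = {x. (\<forall>i\<ge>n. x i = 0) \<and> (\<Sum>i<n. (x i)\<^sup>2) \<le> 1}"
  by (auto simp: unit_disc_def topspace_Euclidean_space)

lemma unit_disc_eq: "unit_disc n = subtopology euclidean (topspace (unit_disc n))"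
  by (auto simp: unit_disc_def topspace_Euclidean_space Euclidean_space_def subtopology_subtopology
      euclidean_product_topology intro!: arg_cong2[where f = subtopology])

text \<open>Points of the disc are functions on all natural numbers, so compactness comes from
  Tychonoff: the disc is cut out of the product of the intervals from -1 to 1 by closed
  conditions.\<close>

lemma compact_unit_disc: "compact_space (unit_disc n)"
proof -
  let ?D = "topspace (unit_disc n)"
  have *: "\<bar>x i\<bar> \<le> 1" if "x \<in> ?D" for x i
  proof (cases "i < n")
    case True
    have "(x i)\<^sup>2 \<le> (\<Sum>i<n. (x i)\<^sup>2)"
      using True by (intro member_le_sum) auto
    also have "\<dots> \<le> 1" using that by (simp add: topspace_unit_disc)
    finally show ?thesis by (simp add: abs_square_le_1)
  qed (use that in \<open>simp add: topspace_unit_disc\<close>)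
  have "compactin (powertop_real UNIV) (PiE UNIV (\<lambda>_. {-1..1::real}))"
    by (simp add: compactin_PiE)
  then have c: "compact (PiE UNIV (\<lambda>_::nat. {-1..1::real}))"
    by (simp add: euclidean_product_topology)
  have "closed {x :: nat \<Rightarrow> real. x i = 0}" for i
    by (intro closed_Collect_eq continuous_on_product_coordinates continuous_on_const)
  then have "closed (\<Inter>i\<in>{n..}. {x :: nat \<Rightarrow> real. x i = 0})" by blast
  moreover have "closed {x :: nat \<Rightarrow> real. (\<Sum>i<n. (x i)\<^sup>2) \<le> 1}"
    by (intro closed_Collect_le continuous_intros continuous_on_product_coordinates)
  ultimately have "closed ((\<Inter>i\<in>{n..}. {x :: nat \<Rightarrow> real. x i = 0}) \<inter> {x. (\<Sum>i<n. (x i)\<^sup>2) \<le> 1})"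
    by blast
  moreover have "(\<Inter>i\<in>{n..}. {x :: nat \<Rightarrow> real. x i = 0}) \<inter> {x. (\<Sum>i<n. (x i)\<^sup>2) \<le> 1} = ?D"
    by (auto simp: topspace_unit_disc)
  ultimately have "compact (PiE UNIV (\<lambda>_::nat. {-1..1::real}) \<inter> ?D)"
    using c by (metis compact_Int_closed)
  moreover have "PiE UNIV (\<lambda>_::nat. {-1..1::real}) \<inter> ?D = ?D"
    using * by (fastforce simp: abs_le_iff)
  ultimately show ?thesis
    by (subst unit_disc_eq) (simp add: compact_space_subtopology)
qed

lemma Hausdorff_unit_disc: "Hausdorff_space (unit_disc n)"
  by (subst unit_disc_eq) (simp add: Hausdorff_space_subtopology)

lemma closedin_sphere: "closedin (unit_disc n) (topspace (unit_disc n) - open_disc n)"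
proof -
  have "closed {x :: nat \<Rightarrow> real. 1 \<le> (\<Sum>i<n. (x i)\<^sup>2)}"
    by (intro closed_Collect_le continuous_intros continuous_on_product_coordinates)
  moreover have "topspace (unit_disc n) - open_disc n =
      topspace (unit_disc n) \<inter> {x. 1 \<le> (\<Sum>i<n. (x i)\<^sup>2)}"
    by (auto simp: open_disc_def)
  ultimately show ?thesis
    by (subst unit_disc_eq) (simp add: closedin_closed_Int)
qed

lemma open_disc_subset: "open_disc n \<subseteq> topspace (unit_disc n)"
  by (auto simp: open_disc_def)

lemma normal_space_unit_disc: "normal_space (unit_disc n)"
  using compact_Hausdorff_or_regular_imp_normal_space compact_unit_disc Hausdorff_unit_disc by blast

lemma Tietze_extension_real:
  assumes "normal_space X" "closedin X S" "continuous_map (subtopology X S) euclideanreal f"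
  shows "\<exists>g. continuous_map X euclideanreal g \<and> (\<forall>x \<in> S. g x = f x)"
  by (rule Tietze_extension_realinterval[OF assms(1,2) is_interval_univ UNIV_not_empty assms(3) subset_UNIV])
    blast

text \<open>Urysohn functions are built skeleton by skeleton, extending over each cell by Tietze.\<close>

lemma normal_space_CW_complex:
  fixes Y :: "'a topology"
  assumes "CW_complex Y"
  shows "normal_space Y"
  unfolding normal_space_iff_Urysohn_alt
proof (intro allI impI, elim conjE)
  fix S T assume S: "closedin Y S" and T: "closedin Y T" and ST: "disjnt S T"
  obtain cells :: "(nat \<times> ((nat \<Rightarrow> real) \<Rightarrow> 'a)) set" where Y: "Hausdorff_space Y"
    and maps: "\<forall>(n, \<phi>) \<in> cells. continuous_map (unit_disc n) Y \<phi> \<and> inj_on \<phi> (open_disc n)"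
    and disj: "disjoint_family_on (\<lambda>(n, \<phi>). \<phi> ` open_disc n) cells"
    and cover: "(\<Union>(n, \<phi>) \<in> cells. \<phi> ` open_disc n) = topspace Y"
    and bds: "\<forall>(n, \<phi>) \<in> cells. \<exists>lower \<subseteq> cells. finite lower \<and> (\<forall>(m, \<psi>) \<in> lower. m < n) \<and>
          \<phi> ` (topspace (unit_disc n) - open_disc n) \<subseteq> (\<Union>(m, \<psi>) \<in> lower. \<psi> ` open_disc m)"
    and closed: "\<forall>S \<subseteq> topspace Y.
          (\<forall>(n, \<phi>) \<in> cells. closedin Y (S \<inter> \<phi> ` topspace (unit_disc n))) \<longrightarrow> closedin Y S"
    using assms unfolding CW_complex_def by (elim conjE exE) (rule that)
  have cont: "continuous_map (unit_disc n) Y \<phi>" and inj: "inj_on \<phi> (open_disc n)"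
    if "(n, \<phi>) \<in> cells" for n \<phi>
    using bspec[OF maps that] by simp_all
  have bd: "\<exists>lower \<subseteq> cells. finite lower \<and> (\<forall>(m, \<psi>) \<in> lower. m < n) \<and>
          \<phi> ` (topspace (unit_disc n) - open_disc n) \<subseteq> (\<Union>(m, \<psi>) \<in> lower. \<psi> ` open_disc m)"
    if "(n, \<phi>) \<in> cells" for n \<phi>
    using bspec[OF bds that] unfolding prod.case .
  have weak: "closedin Y C" if "C \<subseteq> topspace Y"
    "\<And>n \<phi>. (n, \<phi>) \<in> cells \<Longrightarrow> closedin Y (C \<inter> \<phi> ` topspace (unit_disc n))" for C
    using closed that by (simp add: split_beta)
  let ?D = "\<lambda>n. topspace (unit_disc n)"
  \<comment> \<open>\<open>X n\<close> is the skeleton of dimension n - 1. The strict bound makes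
    \<open>X 0\<close> empty, so the recursion can start without any continuity condition.\<close>
  define X where "X n = (\<Union>(m, \<phi>) \<in> {c \<in> cells. fst c < n}. \<phi> ` open_disc m)" for n
  have XI: "\<phi> d \<in> X n" if "(m, \<phi>) \<in> cells" "m < n" "d \<in> open_disc m" for m n \<phi> d
    unfolding X_def by (rule UN_I[of "(m, \<phi>)"]) (use that in auto)
  have Xmono: "X m \<subseteq> X n" if "m \<le> n" for m n using that unfolding X_def by fastforce
  have bdX: "\<phi> d \<in> X n" if c: "(n, \<phi>) \<in> cells" and d: "d \<in> ?D n - open_disc n" for n \<phi> d
  proof -
    obtain lower where "lower \<subseteq> cells" "\<forall>(m, \<psi>) \<in> lower. m < n" "\<phi> d \<in> (\<Union>(m, \<psi>) \<in> lower. \<psi> ` open_disc m)"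
      using bd[OF c] d by blast
    then obtain c e where "c \<in> lower" "e \<in> open_disc (fst c)" "\<phi> d = snd c e" by (auto simp: split_beta)
    moreover have "fst c < n" "(fst c, snd c) \<in> cells"
      using \<open>c \<in> lower\<close> \<open>lower \<subseteq> cells\<close> \<open>\<forall>(m, \<psi>) \<in> lower. m < n\<close> by (auto simp: split_beta)
    ultimately show ?thesis using XI[of "fst c" "snd c" n e] by simp
  qed
  have DX: "\<phi> d \<in> X n" if "(m, \<phi>) \<in> cells" "m < n" "d \<in> ?D m" for m n \<phi> d
    using that XI[of m \<phi> n d] bdX[of m \<phi> d] Xmono[of m n] by (cases "d \<in> open_disc m") auto
  have notX: "\<phi> d \<notin> X n" if c: "(n, \<phi>) \<in> cells" and d: "d \<in> open_disc n" for n \<phi> d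
  proof
    assume "\<phi> d \<in> X n"
    then obtain m \<psi> where m: "(m, \<psi>) \<in> cells" "m < n" "\<phi> d \<in> \<psi> ` open_disc m"
      unfolding X_def by auto
    then have "(\<phi> ` open_disc n) \<inter> (\<psi> ` open_disc m) = {}"
      using disjoint_family_onD[OF disj c m(1)] by auto
    then show False using d m(3) by blast
  qed
  have uniq: "\<phi> = \<psi> \<and> d = e" if "(n, \<phi>) \<in> cells" "(n, \<psi>) \<in> cells" "d \<in> open_disc n" "e \<in> open_disc n"
    "\<phi> d = \<psi> e" for n \<phi> \<psi> d e
  proof -
    have "\<phi> = \<psi>"
    proof (rule ccontr)
      assume "\<phi> \<noteq> \<psi>"
      then have "(\<phi> ` open_disc n) \<inter> (\<psi> ` open_disc n) = {}"
        using disjoint_family_onD[OF disj that(1,2)] by auto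
      then show False using that by blast
    qed
    then show ?thesis using that inj[OF that(1)] by (auto dest: inj_onD)
  qed
  \<comment> \<open>At stage \<open>n\<close> the values on all of \<open>S\<close> and
    \<open>T\<close> are already right, while continuity is required only along cells of dimension
    below \<open>n\<close>; all other values are provisional.\<close>
  define P where "P n f \<longleftrightarrow> (\<forall>(m, \<phi>) \<in> cells. m < n \<longrightarrow> continuous_map (unit_disc m) euclideanreal (f \<circ> \<phi>))
    \<and> (\<forall>y \<in> S. f y = 0) \<and> (\<forall>y \<in> T. f y = 1)" for n and f :: "'a \<Rightarrow> real"
  define Q where "Q n f f' \<longleftrightarrow> (\<forall>y \<in> X n. f' y = f y)" for n and f f' :: "'a \<Rightarrow> real"
  have closed_cell: "closedin Y (\<phi> ` ?D n)" if "(n, \<phi>) \<in> cells" for n \<phi>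
    using that cont compact_unit_disc Y
    by (meson compact_space_def compactin_imp_closedin image_compactin)
  have cell_cont: "continuous_map (subtopology Y (\<phi> ` ?D n)) euclideanreal f"
    if c: "(n, \<phi>) \<in> cells" and f: "continuous_map (unit_disc n) euclideanreal (f \<circ> \<phi>)" for n \<phi> f
  proof -
    have "quotient_map (unit_disc n) (subtopology Y (\<phi> ` ?D n)) \<phi>"
    proof (rule continuous_imp_quotient_map)
      show "continuous_map (unit_disc n) (subtopology Y (\<phi> ` ?D n)) \<phi>"
        using cont[OF c] by (auto simp: continuous_map_in_subtopology)
      show "\<phi> ` ?D n = topspace (subtopology Y (\<phi> ` ?D n))"
        using closedin_subset[OF closed_cell[OF c]] by auto
    qed (auto simp: compact_unit_disc Y Hausdorff_space_subtopology)
    then show ?thesis using f continuous_compose_quotient_map by blast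
  qed
  \<comment> \<open>On a closed cell the values are prescribed on the sphere and over
    \<open>S\<close> and \<open>T\<close>. By closure-finiteness the sphere lands in a finite union
    \<open>W\<close> of closed cells of lower dimension, on which \<open>f\<close> is continuous by
    pasting; Tietze extends from the closed set where values are prescribed.\<close>
  have ext: "\<exists>h. continuous_map (unit_disc n) euclideanreal h \<and>
      (\<forall>d \<in> ?D n. d \<notin> open_disc n \<or> \<phi> d \<in> S \<or> \<phi> d \<in> T \<longrightarrow> h d = f (\<phi> d))"
    if c: "(n, \<phi>) \<in> cells" and P: "P n f" for n \<phi> f
  proof -
    obtain lower where low: "lower \<subseteq> cells" "finite lower" "\<forall>(m, \<psi>) \<in> lower. m < n"
      and bdl: "\<phi> ` (?D n - open_disc n) \<subseteq> (\<Union>(m, \<psi>) \<in> lower. \<psi> ` open_disc m)"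
      using bd[OF c] by blast
    define W where "W = (\<Union>(m, \<psi>) \<in> lower. \<psi> ` ?D m)"
    have fW: "continuous_map (subtopology Y W) euclideanreal f"
    proof (rule pasting_lemma_closed[where I = lower and T = "\<lambda>(m, \<psi>). \<psi> ` ?D m" and f = "\<lambda>_. f"])
      fix i assume i: "i \<in> lower"
      obtain m \<psi> where [simp]: "i = (m, \<psi>)" by (cases i)
      have sub: "\<psi> ` ?D m \<subseteq> W" using i by (auto simp: W_def)
      have c': "(m, \<psi>) \<in> cells" "m < n" using i low by auto
      show "closedin (subtopology Y W) (case i of (m, \<psi>) \<Rightarrow> \<psi> ` ?D m)"
        using closed_cell[OF c'(1)] sub by (simp add: closedin_subset_topspace)
      have "continuous_map (subtopology Y (\<psi> ` ?D m)) euclideanreal f"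
        using cell_cont c' P by (auto simp: P_def)
      then show "continuous_map (subtopology (subtopology Y W) (case i of (m, \<psi>) \<Rightarrow> \<psi> ` ?D m)) euclideanreal f"
        using sub by (simp add: subtopology_subtopology inf.absorb2)
    next
      fix x assume "x \<in> topspace (subtopology Y W)"
      then show "\<exists>j. j \<in> lower \<and> x \<in> (case j of (m, \<psi>) \<Rightarrow> \<psi> ` ?D m) \<and> f x = f x"
        by (auto simp: W_def)
    qed (use low in auto)
    let ?Z1 = "?D n - open_disc n" and ?Z2 = "{d \<in> ?D n. \<phi> d \<in> S}" and ?Z3 = "{d \<in> ?D n. \<phi> d \<in> T}"
    have cl: "closedin (unit_disc n) ?Z1" "closedin (unit_disc n) ?Z2" "closedin (unit_disc n) ?Z3"
      using closedin_sphere closedin_continuous_map_preimage[OF cont[OF c]] S T by auto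
    have c1: "continuous_map (subtopology (unit_disc n) ?Z1) euclideanreal (f \<circ> \<phi>)"
    proof (rule continuous_map_compose[OF _ fW])
      have "(\<Union>(m, \<psi>) \<in> lower. \<psi> ` open_disc m) \<subseteq> W"
        unfolding W_def by (rule UN_mono[OF subset_refl]) (simp add: split_beta image_mono open_disc_subset)
      with bdl have "\<phi> ` ?Z1 \<subseteq> W" by blast
      then show "continuous_map (subtopology (unit_disc n) ?Z1) (subtopology Y W) \<phi>"
        using cont[OF c] by (auto simp: continuous_map_in_subtopology continuous_map_from_subtopology)
    qed
    have c2: "continuous_map (subtopology (unit_disc n) ?Z2) euclideanreal (f \<circ> \<phi>)"
      by (rule continuous_map_eq[where f = "\<lambda>_. 0"]) (use P in \<open>auto simp: P_def\<close>)
    have c3: "continuous_map (subtopology (unit_disc n) ?Z3) euclideanreal (f \<circ> \<phi>)"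
      by (rule continuous_map_eq[where f = "\<lambda>_. 1"]) (use P in \<open>auto simp: P_def\<close>)
    let ?Z = "?Z1 \<union> ?Z2 \<union> ?Z3"
    have clZ: "closedin (unit_disc n) ?Z" using cl by blast
    have "continuous_map (subtopology (unit_disc n) ?Z) euclideanreal (f \<circ> \<phi>)"
    proof (rule pasting_lemma_closed[where I = "{?Z1, ?Z2, ?Z3}" and T = "\<lambda>Z. Z" and f = "\<lambda>_. f \<circ> \<phi>"])
      fix Z assume Z: "Z \<in> {?Z1, ?Z2, ?Z3}"
      then have "closedin (unit_disc n) Z" "Z \<subseteq> ?Z" using cl by blast+
      then show "closedin (subtopology (unit_disc n) ?Z) Z" by (simp add: closedin_subset_topspace)
      have "continuous_map (subtopology (unit_disc n) Z) euclideanreal (f \<circ> \<phi>)"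
        using Z c1 c2 c3 by blast
      then show "continuous_map (subtopology (subtopology (unit_disc n) ?Z) Z) euclideanreal (f \<circ> \<phi>)"
        using \<open>Z \<subseteq> ?Z\<close> by (simp only: subtopology_subtopology inf.absorb2)
    qed auto
    from Tietze_extension_real[OF normal_space_unit_disc clZ this]
    obtain h where "continuous_map (unit_disc n) euclideanreal h" and h: "\<forall>d \<in> ?Z. h d = (f \<circ> \<phi>) d"
      by blast
    moreover have "h d = f (\<phi> d)" if "d \<in> ?D n" "d \<notin> open_disc n \<or> \<phi> d \<in> S \<or> \<phi> d \<in> T" for d
      using bspec[OF h, of d] that by simp
    ultimately show ?thesis by blast
  qed
  have step: "\<exists>f'. P (Suc n) f' \<and> Q n f f'" if P: "P n f" for n f
  proof -
    obtain h where h: "\<And>\<phi>. (n, \<phi>) \<in> cells \<Longrightarrow> continuous_map (unit_disc n) euclideanreal (h \<phi>)"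
      "\<And>\<phi> d. (n, \<phi>) \<in> cells \<Longrightarrow> d \<in> ?D n \<Longrightarrow> d \<notin> open_disc n \<or> \<phi> d \<in> S \<or> \<phi> d \<in> T \<Longrightarrow> h \<phi> d = f (\<phi> d)"
      using ext[OF _ P] by metis
    \<comment> \<open>A point of an open \<open>n\<close>-cell has a unique characteristic map and
      coordinate, so choosing them is harmless. Off these cells, in particular on
      \<open>X n\<close>, the old values are kept.\<close>
    define R where "R y c \<longleftrightarrow> (n, fst c) \<in> cells \<and> snd c \<in> open_disc n \<and> y = fst c (snd c)"
      for y and c :: "((nat \<Rightarrow> real) \<Rightarrow> 'a) \<times> (nat \<Rightarrow> real)"
    define f' where "f' y = (if \<exists>c. R y c then let c = SOME c. R y c in h (fst c) (snd c) else f y)" for y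
    have f'open: "f' (\<phi> d) = h \<phi> d" if "(n, \<phi>) \<in> cells" "d \<in> open_disc n" for \<phi> d
    proof -
      have R: "R (\<phi> d) (\<phi>, d)" using that by (simp add: R_def)
      have "c = (\<phi>, d)" if "R (\<phi> d) c" for c
        using uniq[of n \<phi> "fst c" d "snd c"] that \<open>(n, \<phi>) \<in> cells\<close> \<open>d \<in> open_disc n\<close>
        unfolding R_def by (metis prod.collapse)
      with R have "(SOME c. R (\<phi> d) c) = (\<phi>, d)" by (intro some_equality) blast+
      then show ?thesis using R by (auto simp: f'_def)
    qed
    have f'X: "f' y = f y" if "y \<in> X n" for y
      using that notX by (auto simp: f'_def R_def)
    have f'cell: "f' (\<phi> d) = h \<phi> d" if "(n, \<phi>) \<in> cells" "d \<in> ?D n" for \<phi> d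
      using that f'open[of \<phi> d] f'X[of "\<phi> d"] bdX[of n \<phi> d] h(2)[of \<phi> d] by (cases "d \<in> open_disc n") simp_all
    have f'ST: "f' y = f y" if "y \<in> S \<union> T" for y
    proof (cases "\<exists>c. R y c")
      case True
      then obtain \<phi> d where "(n, \<phi>) \<in> cells" "d \<in> open_disc n" "y = \<phi> d" by (auto simp: R_def)
      then show ?thesis using f'open h(2)[of \<phi> d] that open_disc_subset by auto
    qed (simp add: f'_def)
    have "continuous_map (unit_disc m) euclideanreal (f' \<circ> \<phi>)" if c: "(m, \<phi>) \<in> cells" and m: "m < Suc n" for m \<phi>
    proof (cases "m = n")
      case True
      then have "continuous_map (unit_disc m) euclideanreal (h \<phi>)" using h c by simp
      then show ?thesis by (rule continuous_map_eq) (use f'cell c True in auto)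
    next
      case False
      then have mn: "m < n" using m by simp
      then have "continuous_map (unit_disc m) euclideanreal (f \<circ> \<phi>)" using P c by (auto simp: P_def)
      then show ?thesis by (rule continuous_map_eq) (use f'X DX[OF c mn] in auto)
    qed
    then have "P (Suc n) f'" using f'ST P unfolding P_def by auto
    moreover have "Q n f f'" using f'X by (simp add: Q_def)
    ultimately show ?thesis by blast
  qed
  \<comment> \<open>Disjointness of \<open>S\<close> and \<open>T\<close> makes the indicator of
    \<open>T\<close> a valid start; no cell has dimension below 0, so it need not be
    continuous.\<close>
  have "P 0 (\<lambda>y. if y \<in> T then 1 else 0)" using ST by (auto simp: P_def disjnt_iff)
  then obtain F where F: "\<And>n. P n (F n)" "\<And>n. Q n (F n) (F (Suc n))"
    using dependent_nat_choice[of P Q] step by metis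
  have FF: "F k y = F n y" if "n \<le> k" "y \<in> X n" for k n y
    using that
  proof (induction k rule: dec_induct)
    case (step k)
    then show ?case using F(2)[of k] Xmono[of n k] by (auto simp: Q_def)
  qed simp
  define f where "f y = F (LEAST n. y \<in> X n) y" for y
  have fF: "f y = F n y" if "y \<in> X n" for n y
    unfolding f_def using that FF[of "LEAST n. y \<in> X n" n y] by (metis LeastI Least_le)
  have YX: "\<exists>n. y \<in> X n" if y: "y \<in> topspace Y" for y
  proof -
    obtain n \<phi> d where "(n, \<phi>) \<in> cells" "d \<in> open_disc n" "y = \<phi> d"
      using y unfolding cover[symmetric] by auto
    then show ?thesis using XI[of n \<phi> "Suc n" d] by blast
  qed
  have fc: "continuous_map (unit_disc m) euclideanreal (f \<circ> \<phi>)" if c: "(m, \<phi>) \<in> cells" for m \<phi>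
  proof -
    have "continuous_map (unit_disc m) euclideanreal (F (Suc m) \<circ> \<phi>)"
      using F(1)[of "Suc m"] c by (auto simp: P_def)
    then show ?thesis by (rule continuous_map_eq) (use fF[of _ "Suc m"] DX[OF c, of "Suc m"] in simp)
  qed
  have "continuous_map Y euclideanreal f"
    unfolding continuous_map_closedin
  proof (intro conjI allI impI)
    fix C :: "real set" assume C: "closedin euclideanreal C"
    show "closedin Y {y \<in> topspace Y. f y \<in> C}"
    proof (rule weak)
      fix n \<phi> assume c: "(n, \<phi>) \<in> cells"
      have "closedin (unit_disc n) {d \<in> ?D n. (f \<circ> \<phi>) d \<in> C}"
        using closedin_continuous_map_preimage[OF fc[OF c] C] .
      then have "compactin (unit_disc n) {d \<in> ?D n. (f \<circ> \<phi>) d \<in> C}"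
        using closedin_compact_space compact_unit_disc by blast
      then have "closedin Y (\<phi> ` {d \<in> ?D n. (f \<circ> \<phi>) d \<in> C})"
        by (rule compactin_imp_closedin[OF Y image_compactin[OF _ cont[OF c]]])
      moreover have "\<phi> ` {d \<in> ?D n. (f \<circ> \<phi>) d \<in> C} = {y \<in> topspace Y. f y \<in> C} \<inter> \<phi> ` ?D n"
        using closedin_subset[OF closed_cell[OF c]] by auto
      ultimately show "closedin Y ({y \<in> topspace Y. f y \<in> C} \<inter> \<phi> ` ?D n)" by simp
    qed auto
  qed auto
  moreover have "f y = 0" if "y \<in> S" for y
    using YX[of y] closedin_subset[OF S] that fF[of y] F(1) by (auto simp: P_def)
  moreover have "f y = 1" if "y \<in> T" for y
    using YX[of y] closedin_subset[OF T] that fF[of y] F(1) by (auto simp: P_def)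
  ultimately show "\<exists>f. continuous_map Y euclideanreal f \<and> f ` S \<subseteq> {0} \<and> f ` T \<subseteq> {1}"
    by (intro exI[of _ f]) auto
qed

section \<open>Deformations from a categorical cover\<close>

text \<open>Induction on the number of sets. The part of \<open>D\<close> outside the last set has
  an open neighbourhood \<open>W\<close> whose closure still lies in the union of the others. The
  induction hypothesis handles \<open>D\<close> within that closure, and the rest,
  \<open>D - W\<close>, is closed and contained in the last set.\<close>

lemma normal_space_shrinking:
  fixes m :: nat
  assumes "normal_space Y" "closedin Y D"
    and "\<And>i. i \<le> m \<Longrightarrow> openin Y (V i)" and "D \<subseteq> (\<Union>i\<le>m. V i)"
  shows "\<exists>C. (\<forall>i\<le>m. closedin Y (C i) \<and> C i \<subseteq> V i) \<and> D \<subseteq> (\<Union>i\<le>m. C i)"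
  using assms(2-)
proof (induction m arbitrary: D)
  case 0
  then show ?case by (intro exI[of _ "\<lambda>_. D"]) auto
next
  case (Suc m)
  let ?V = "\<Union>i\<le>m. V i"
  have "D - V (Suc m) \<subseteq> ?V" using Suc.prems(3) by (auto simp: atMost_Suc)
  moreover have "closedin Y (D - V (Suc m))" using Suc.prems(1,2) by (simp add: closedin_diff)
  moreover have "openin Y ?V" using Suc.prems(2) by auto
  ultimately obtain W where W: "openin Y W" "D - V (Suc m) \<subseteq> W" "Y closure_of W \<subseteq> ?V"
    using assms(1) unfolding normal_space_alt by metis
  have "closedin Y (D \<inter> Y closure_of W)" using Suc.prems(1) by (simp add: closedin_Int)
  moreover have "D \<inter> Y closure_of W \<subseteq> ?V" using W by blast
  ultimately obtain C where C: "\<forall>i\<le>m. closedin Y (C i) \<and> C i \<subseteq> V i"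
    "D \<inter> Y closure_of W \<subseteq> (\<Union>i\<le>m. C i)"
    using Suc.IH Suc.prems(2) le_SucI by metis
  define C' where "C' = C(Suc m := D - W)"
  have "\<forall>i\<le>Suc m. closedin Y (C' i) \<and> C' i \<subseteq> V i"
    using C(1) W Suc.prems(1) by (auto simp: C'_def closedin_diff le_Suc_eq)
  moreover have "W \<subseteq> Y closure_of W" using W(1) by (simp add: closure_of_subset openin_subset)
  then have "D \<subseteq> (\<Union>i\<le>Suc m. C' i)"
    using C(2) by (fastforce simp: C'_def atMost_Suc)
  ultimately show ?case by blast
qed

lemma homotopic_with_trivialI:
  assumes "continuous_map (prod_topology unit_interval X) Y h"
    and "\<And>x. x \<in> topspace X \<Longrightarrow> h (0, x) = f x" and "\<And>x. x \<in> topspace X \<Longrightarrow> h (1, x) = g x"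
  shows "homotopic_with (\<lambda>_. True) X Y f g"
  by (subst homotopic_with) (use assms in auto)

lemma homotopic_with_trivialD:
  assumes "homotopic_with (\<lambda>_. True) X Y f g"
  shows "\<exists>h. continuous_map (prod_topology unit_interval X) Y h \<and> (\<forall>x. h (0, x) = f x) \<and> (\<forall>x. h (1, x) = g x)"
  using assms unfolding homotopic_with_def by blast

text \<open>A homotopy defined only over an open set is run for a time given by a bump function.\<close>

lemma homotopy_cutoff:
  assumes Y: "normal_space Y" and \<beta>: "continuous_map Y F \<beta>"
    and V: "openin Y {y \<in> topspace Y. \<beta> y \<in> U}"
    and C: "closedin Y C" "C \<subseteq> {y \<in> topspace Y. \<beta> y \<in> U}"
    and hom: "homotopic_with (\<lambda>_. True) (subtopology F U) F id q"
  shows "\<exists>l. homotopic_with (\<lambda>_. True) Y F \<beta> l \<and> (\<forall>y \<in> C. l y = q (\<beta> y))"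
proof -
  let ?V = "{y \<in> topspace Y. \<beta> y \<in> U}"
  obtain H where H: "continuous_map (prod_topology unit_interval (subtopology F U)) F H"
    "\<And>x. H (0, x) = x" "\<And>x. H (1, x) = q x"
    using homotopic_with_trivialD[OF hom] by auto
  have "closedin Y (topspace Y - ?V)" using V by blast
  moreover have "disjnt (topspace Y - ?V) C" using C(2) by (auto simp: disjnt_iff)
  ultimately obtain \<rho> where \<rho>: "continuous_map Y (top_of_set {0..1}) \<rho>" "\<rho> ` (topspace Y - ?V) \<subseteq> {0::real}"
    "\<rho> ` C \<subseteq> {1}"
    using Urysohn_lemma[OF Y _ C(1), of "topspace Y - ?V" 0 1] by auto
  have \<rho>c: "continuous_map Y euclideanreal \<rho>" and \<rho>1: "\<And>y. y \<in> topspace Y \<Longrightarrow> \<rho> y \<le> 1"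
    using \<rho>(1) by (auto simp: continuous_map_in_subtopology)
  let ?P = "prod_topology unit_interval Y"
  \<comment> \<open>The set where \<rho> \<ge> 1/2 is closed and lies inside the preimage of
    \<open>U\<close>, because \<rho> vanishes off that preimage; so \<open>H\<close> is used only
    where it is defined. The factor 2\<rho> - 1 is 0 at the seam, where both branches agree, and 1
    on \<open>C\<close>, where \<open>H\<close> runs to its end.\<close>
  define K where "K = (\<lambda>z. if \<rho> (snd z) \<le> 1/2 then \<beta> (snd z) else H (fst z * (2 * \<rho> (snd z) - 1), \<beta> (snd z)))"
  have \<rho>s: "continuous_map ?P euclideanreal (\<lambda>z. \<rho> (snd z))"
    using continuous_map_compose[OF continuous_map_snd \<rho>c] by (simp add: o_def)
  have \<beta>s: "continuous_map ?P F (\<lambda>z. \<beta> (snd z))"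
    using continuous_map_compose[OF continuous_map_snd \<beta>] by (simp add: o_def)
  have fs: "continuous_map ?P euclideanreal fst"
    using continuous_map_fst[of unit_interval Y] by (simp add: continuous_map_in_subtopology)
  have "continuous_map ?P F K"
    unfolding K_def
  proof (rule continuous_map_cases_le)
    show "continuous_map ?P euclideanreal (\<lambda>z. \<rho> (snd z))" by (rule \<rho>s)
    show "continuous_map (subtopology ?P {z \<in> topspace ?P. \<rho> (snd z) \<le> 1/2}) F (\<lambda>z. \<beta> (snd z))"
      using \<beta>s by (rule continuous_map_from_subtopology)
    let ?Z = "subtopology ?P {z \<in> topspace ?P. 1/2 \<le> \<rho> (snd z)}"
    have "continuous_map ?Z (prod_topology unit_interval (subtopology F U))
        (\<lambda>z. (fst z * (2 * \<rho> (snd z) - 1), \<beta> (snd z)))"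
      unfolding continuous_map_pairwise o_def fst_conv snd_conv continuous_map_in_subtopology
    proof (intro conjI)
      show "continuous_map ?Z euclideanreal (\<lambda>z. fst z * (2 * \<rho> (snd z) - 1))"
        by (intro continuous_map_real_mult continuous_map_diff continuous_map_const[THEN iffD2]
            continuous_map_from_subtopology fs \<rho>s) auto
      show "(\<lambda>z. fst z * (2 * \<rho> (snd z) - 1)) \<in> topspace ?Z \<rightarrow> {0..1}"
        using \<rho>1 by (auto intro!: mult_le_one)
      show "continuous_map ?Z F (\<lambda>z. \<beta> (snd z))"
        using \<beta>s by (rule continuous_map_from_subtopology)
      show "(\<lambda>z. \<beta> (snd z)) \<in> topspace ?Z \<rightarrow> U"
        using \<rho>(2) by fastforce
    qed
    from continuous_map_compose[OF this H(1)]
    show "continuous_map ?Z F (\<lambda>z. H (fst z * (2 * \<rho> (snd z) - 1), \<beta> (snd z)))"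
      by (simp add: o_def)
    fix z assume "z \<in> topspace ?P" "\<rho> (snd z) = 1/2"
    then have "2 * \<rho> (snd z) - 1 = 0" by simp
    then show "\<beta> (snd z) = H (fst z * (2 * \<rho> (snd z) - 1), \<beta> (snd z))"
      by (simp only: mult_zero_right H(2))
  qed simp
  then have "homotopic_with (\<lambda>_. True) Y F \<beta> (\<lambda>y. K (1, y))"
    by (rule homotopic_with_trivialI) (auto simp: K_def H(2))
  moreover have "K (1, y) = q (\<beta> y)" if "y \<in> C" for y
    using \<rho>(3) that by (auto simp: K_def H(3) image_subset_iff)
  ultimately show ?thesis by blast
qed

text \<open>Normality is at hand for the CW-complex \<open>Y\<close>, not for \<open>F\<close>. So
  the cover is pulled back along \<beta> and shrunk on \<open>Y\<close>, the homotopies are cut off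
  as homotopies of \<beta>, and precomposing with \<alpha> returns to \<open>F\<close>, where
  \<beta> \<circ> \<alpha> is homotopic to the identity.\<close>

lemma CW_type_cover_deformations:
  fixes F :: "'a topology" and m :: nat
  assumes F: "CW_type F"
    and U: "\<And>i. i \<le> m \<Longrightarrow> openin F (U i)" "(\<Union>i\<le>m. U i) = topspace F"
    and hom: "\<And>i. i \<le> m \<Longrightarrow> homotopic_with (\<lambda>_. True) (subtopology F (U i)) F id (q i)"
    and q: "\<And>i x. i \<le> m \<Longrightarrow> x \<in> U i \<Longrightarrow> q i x \<in> S"
  shows "\<exists>l. (\<forall>i\<le>m. homotopic_with (\<lambda>_. True) F F id (l i)) \<and> (\<forall>x \<in> topspace F. \<exists>i\<le>m. l i x \<in> S)"
proof -
  obtain Y :: "('a \<times> real) topology" where Y: "CW_complex Y" "F homotopy_equivalent_space Y"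
    using F unfolding CW_type_def by blast
  then obtain \<alpha> \<beta> where \<alpha>: "continuous_map F Y \<alpha>" and \<beta>: "continuous_map Y F \<beta>"
    and \<beta>\<alpha>: "homotopic_with (\<lambda>_. True) F F (\<beta> \<circ> \<alpha>) id"
    unfolding homotopy_equivalent_space_def by blast
  have nY: "normal_space Y" using Y(1) by (rule normal_space_CW_complex)
  let ?V = "\<lambda>i. {y \<in> topspace Y. \<beta> y \<in> U i}"
  have V: "openin Y (?V i)" if "i \<le> m" for i
    using \<beta> U(1)[OF that] by (rule openin_continuous_map_preimage)
  have \<beta>Y: "\<beta> y \<in> topspace F" if "y \<in> topspace Y" for y
    using \<beta> that by (auto simp: continuous_map_def)
  have "topspace Y \<subseteq> (\<Union>i\<le>m. ?V i)"
    using \<beta>Y unfolding U(2)[symmetric] by auto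
  then have "\<exists>C. (\<forall>i\<le>m. closedin Y (C i) \<and> C i \<subseteq> ?V i) \<and> topspace Y \<subseteq> (\<Union>i\<le>m. C i)"
    using normal_space_shrinking[OF nY closedin_topspace, where V = ?V and m = m] V by simp
  then obtain C where C: "\<forall>i\<le>m. closedin Y (C i) \<and> C i \<subseteq> ?V i" "topspace Y \<subseteq> (\<Union>i\<le>m. C i)"
    by blast
  have "\<exists>l. homotopic_with (\<lambda>_. True) Y F \<beta> l \<and> (\<forall>y \<in> C i. l y = q i (\<beta> y))" if "i \<le> m" for i
    using homotopy_cutoff[OF nY \<beta> V[OF that] _ _ hom[OF that]] C(1) that by blast
  then obtain l where l: "\<And>i. i \<le> m \<Longrightarrow> homotopic_with (\<lambda>_. True) Y F \<beta> (l i)"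
    "\<And>i y. i \<le> m \<Longrightarrow> y \<in> C i \<Longrightarrow> l i y = q i (\<beta> y)"
    by metis
  have "homotopic_with (\<lambda>_. True) F F id (l i \<circ> \<alpha>)" if "i \<le> m" for i
    using homotopic_with_trans[OF homotopic_with_symD[OF \<beta>\<alpha>]
        homotopic_with_compose_continuous_map_right[OF l(1)[OF that] \<alpha>]] by simp
  moreover have "\<exists>i\<le>m. (l i \<circ> \<alpha>) x \<in> S" if "x \<in> topspace F" for x
  proof -
    have "\<alpha> x \<in> topspace Y" using \<alpha> that by (auto simp: continuous_map_def)
    then obtain i where i: "i \<le> m" "\<alpha> x \<in> C i" using C(2) by auto
    then have "l i (\<alpha> x) \<in> S" using l(2)[OF i] q[OF i(1)] C(1) by auto
    with i show ?thesis by auto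
  qed
  ultimately show ?thesis by (intro exI[of _ "\<lambda>i. l i \<circ> \<alpha>"]) blast
qed

lemma Inf_enat_attained:
  assumes "Inf N = enat n"
  shows "enat n \<in> N"
proof -
  have "N \<noteq> {}" using assms by (auto simp: Inf_enat_def)
  then have "(LEAST x. x \<in> N) \<in> N" by (metis LeastI ex_in_conv)
  then show ?thesis using assms \<open>N \<noteq> {}\<close> by (simp add: Inf_enat_def)
qed

lemma secat_attained:
  assumes "secat A X f = enat m"
  shows "\<exists>U s. (\<forall>i\<le>m. openin X (U i)) \<and> (\<Union>i\<le>m. U i) = topspace X \<and>
     (\<forall>i\<le>m. continuous_map (subtopology X (U i)) A (s i) \<and>
        homotopic_with (\<lambda>_. True) (subtopology X (U i)) X (f \<circ> s i) id)"
proof -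
  let ?N = "{enat n | n. \<exists>U. (\<forall>i\<le>n. openin X (U i)) \<and> (\<Union>i\<le>n. U i) = topspace X \<and>
     (\<forall>i\<le>n. \<exists>s. continuous_map (subtopology X (U i)) A s \<and>
        homotopic_with (\<lambda>_. True) (subtopology X (U i)) X (f \<circ> s) id)}"
  have "enat m \<in> ?N" using assms unfolding secat_def by (rule Inf_enat_attained)
  then obtain U where "\<forall>i\<le>m. openin X (U i)" "(\<Union>i\<le>m. U i) = topspace X"
     and s: "\<forall>i\<le>m. \<exists>s. continuous_map (subtopology X (U i)) A s \<and>
        homotopic_with (\<lambda>_. True) (subtopology X (U i)) X (f \<circ> s) id"
    by auto
  moreover obtain s where "\<forall>i\<le>m. continuous_map (subtopology X (U i)) A (s i) \<and>
        homotopic_with (\<lambda>_. True) (subtopology X (U i)) X (f \<circ> s i) id"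
    using s by metis
  ultimately show ?thesis by blast
qed

text \<open>A homotopy section over \<open>U i\<close> is read backwards, as a homotopy from the
  inclusion to \<open>f \<circ> s i\<close>. All that is retained of the sections is that their
  composites with \<open>f\<close> end in the image of \<open>f\<close>.\<close>

lemma secat_deformations:
  assumes X: "CW_type X" and m: "secat A X f = enat m"
  shows "\<exists>l. (\<forall>i\<le>m. homotopic_with (\<lambda>_. True) X X id (l i)) \<and>
    (\<forall>x \<in> topspace X. \<exists>i\<le>m. l i x \<in> f ` topspace A)"
proof -
  obtain U s where U: "\<forall>i\<le>m. openin X (U i)" "(\<Union>i\<le>m. U i) = topspace X"
    and s: "\<forall>i\<le>m. continuous_map (subtopology X (U i)) A (s i) \<and>
        homotopic_with (\<lambda>_. True) (subtopology X (U i)) X (f \<circ> s i) id"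
    using secat_attained[OF m] by blast
  show ?thesis
  proof (rule CW_type_cover_deformations[OF X _ U(2)])
    show "homotopic_with (\<lambda>_. True) (subtopology X (U i)) X id (f \<circ> s i)" if "i \<le> m" for i
      using s that homotopic_with_symD by blast
    show "(f \<circ> s i) x \<in> f ` topspace A" if "i \<le> m" "x \<in> U i" for i x
    proof -
      have "x \<in> topspace (subtopology X (U i))" using that U(1) openin_subset by auto
      then have "s i x \<in> topspace A" using s that unfolding continuous_map_def by blast
      then show ?thesis by simp
    qed
  qed (use U in blast)
qed

section \<open>Extension of deformations from the fibre\<close>

lemma homeomorphic_map_quotient_topology:
  assumes "inj_on q (topspace X)"
  shows "homeomorphic_map X (quotient_topology X q) q"
  unfolding homeomorphic_map_def using assms quotient_map_quotient_topology by blast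

text \<open>The homotopy extension property into \<open>B \<times> {0} \<union> {b0} \<times> I\<close> gives a retraction of \<open>B \<times> I\<close>;
  its components are the deformation and (at time 1) the complement of the bump function.\<close>

lemma well_pointed_deformation:
  fixes B :: "'b topology"
  assumes B: "cg_hausdorff B" and wp: "well_pointed B b0"
  shows "\<exists>h u. continuous_map (prod_topology unit_interval B) B h \<and> continuous_map B unit_interval u \<and>
    (\<forall>b \<in> topspace B. h (0, b) = b) \<and> u b0 = 0 \<and> (\<forall>b \<in> topspace B. u b < 1 \<longrightarrow> h (1, b) = b0)"
proof -
  let ?P = "prod_topology B unit_interval"
  define W where "W = {z \<in> topspace ?P. fst z = b0} \<union> {z \<in> topspace ?P. snd z = 0}"
  \<comment> \<open>\<open>cofibration\<close> offers extensions into targets carried by a sum type,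
    so \<open>W\<close> is transported there by \<open>Inr\<close>; \<open>projr\<close> brings the
    extension back.\<close>
  define Z where "Z = quotient_topology (subtopology ?P W) (Inr :: 'b \<times> real \<Rightarrow> 'b + 'b \<times> real)"
  have k: "k_space B" and H: "Hausdorff_space B" using B by (simp_all add: cg_hausdorff_def)
  have b0: "b0 \<in> topspace B" and cof: "cofibration (subtopology B {b0}) B id"
    and clb: "closedin B {b0}"
    using wp by (simp_all add: well_pointed_def)
  have "closedin ?P {z \<in> topspace ?P. fst z \<in> {b0}}"
    using continuous_map_fst clb by (rule closedin_continuous_map_preimage)
  moreover have "closedin ?P {z \<in> topspace ?P. snd z \<in> {0}}"
    using continuous_map_snd by (rule closedin_continuous_map_preimage) (simp add: closedin_closed_subtopology)
  ultimately have W: "closedin ?P W" by (simp add: W_def closedin_Un)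
  have kW: "k_space (subtopology ?P W)"
    using k W unit_interval_compact by (intro k_space_closed_subtopology k_space_prod_topology_right) auto
  have HW: "Hausdorff_space (subtopology ?P W)"
    using H unit_interval_compact by (intro Hausdorff_space_subtopology) (simp add: Hausdorff_space_prod_topology)
  have q: "quotient_map (subtopology ?P W) Z Inr"
    unfolding Z_def by (rule quotient_map_quotient_topology)
  have "homeomorphic_map (subtopology ?P W) Z Inr"
    unfolding Z_def by (rule homeomorphic_map_quotient_topology) simp
  then have "subtopology ?P W homeomorphic_space Z" by (rule homeomorphic_map_imp_homeomorphic_space)
  then have Z: "cg_hausdorff Z"
    using kW HW homeomorphic_k_space homeomorphic_Hausdorff_space unfolding cg_hausdorff_def by blast
  have Inr: "continuous_map (subtopology ?P W) Z Inr" using q by (rule quotient_imp_continuous_map)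
  have h0: "continuous_map B Z (\<lambda>b. Inr (b, 0))"
  proof -
    have "continuous_map B (subtopology ?P W) (\<lambda>b. (b, 0))"
      by (auto simp: continuous_map_in_subtopology continuous_map_pairwise o_def W_def)
    from continuous_map_compose[OF this Inr] show ?thesis by (simp add: o_def)
  qed
  have H0: "continuous_map (prod_topology unit_interval (subtopology B {b0})) Z (\<lambda>(t, b). Inr (b, t))"
  proof -
    have "continuous_map (prod_topology unit_interval (subtopology B {b0})) ?P (\<lambda>(t, b). (b, t))"
      using continuous_map_swap[of unit_interval "subtopology B {b0}"]
      by (auto simp: continuous_map_pairwise continuous_map_in_subtopology)
    then have "continuous_map (prod_topology unit_interval (subtopology B {b0})) (subtopology ?P W) (\<lambda>(t, b). (b, t))"
      by (auto simp: continuous_map_in_subtopology W_def)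
    from continuous_map_compose[OF this Inr] show ?thesis by (simp add: o_def case_prod_unfold)
  qed
  have "\<forall>a \<in> topspace (subtopology B {b0}). (\<lambda>(t, b). Inr (b, t)) (0, a) = Inr (id a, 0)" by simp
  then obtain K where K: "continuous_map (prod_topology unit_interval B) Z K"
    "\<forall>b \<in> topspace B. K (0, b) = Inr (b, 0)"
    "\<forall>t \<in> {0..1}. \<forall>a \<in> topspace (subtopology B {b0}). K (t, id a) = (\<lambda>(t, b). Inr (b, t)) (t, a)"
    using cof[unfolded cofibration_def, THEN conjunct2, rule_format,
        of Z "\<lambda>b. Inr (b, 0)" "\<lambda>(t, b). Inr (b, t)"] Z h0 H0 by blast
  have "continuous_map Z (subtopology ?P W) projr"
    by (rule continuous_compose_quotient_map[OF q]) (simp add: o_def)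
  from continuous_map_compose[OF K(1) this]
  have r: "continuous_map (prod_topology unit_interval B) (subtopology ?P W) (projr \<circ> K)" .
  have rP: "continuous_map (prod_topology unit_interval B) ?P (projr \<circ> K)"
    using r by (simp add: continuous_map_in_subtopology)
  define h where "h = fst \<circ> (projr \<circ> K)"
  define u where "u b = 1 - snd (projr (K (1, b)))" for b
  have "continuous_map (prod_topology unit_interval B) B h"
    unfolding h_def using rP continuous_map_fst by (rule continuous_map_compose)
  moreover have "continuous_map B unit_interval u"
  proof -
    have "continuous_map B (prod_topology unit_interval B) (\<lambda>b. (1, b))"
      by (simp add: continuous_map_pairwise o_def)
    from continuous_map_compose[OF continuous_map_compose[OF this rP] continuous_map_snd]
    have "continuous_map B unit_interval (\<lambda>b. snd (projr (K (1, b))))" by (simp add: o_def)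
    then show ?thesis
      unfolding u_def continuous_map_in_subtopology
      by (auto intro!: continuous_map_diff)
  qed
  moreover have "\<forall>b \<in> topspace B. h (0, b) = b" using K(2) by (simp add: h_def)
  moreover have "u b0 = 0" using K(3) b0 by (simp add: u_def)
  moreover have "h (1, b) = b0" if b: "b \<in> topspace B" and ub: "u b < 1" for b
  proof -
    have "(projr \<circ> K) (1, b) \<in> topspace (subtopology ?P W)"
      by (rule funcset_mem[OF continuous_map_funspace[OF r]]) (simp add: b)
    \<comment> \<open>A point of \<open>W\<close> at positive height lies over \<open>b0\<close>,
      and u b < 1 says that the height reached is positive.\<close>
    then have "projr (K (1, b)) \<in> W" by simp
    then show ?thesis using ub by (auto simp: W_def h_def u_def)
  qed
  ultimately show ?thesis by blast
qed

text \<open>The contraction of a neighbourhood of \<open>b0\<close> lifts to \<open>H\<close> on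
  \<open>E\<close>, which carries every fibre with u < 1 into \<open>F\<close>. There a deformation
  of \<open>F\<close> can take over, provided it is slowed down to nothing before u reaches
  1.\<close>

lemma fibre_deformations_extend:
  fixes E :: "'e topology" and B :: "'b topology"
  assumes fib: "fibration E B p" and E: "cg_hausdorff E" and B: "cg_hausdorff B"
    and wp: "well_pointed B b0"
    and F: "F = subtopology E {e \<in> topspace E. p e = b0}"
    and l: "\<And>i. i \<in> J \<Longrightarrow> homotopic_with (\<lambda>_. True) F F id (l i)"
    and S: "\<And>x. x \<in> topspace F \<Longrightarrow> \<exists>i \<in> J. l i x \<in> S"
  shows "\<exists>l'. (\<forall>i \<in> J. homotopic_with (\<lambda>_. True) E E id (l' i)) \<and> (\<forall>x \<in> topspace F. \<exists>i \<in> J. l' i x \<in> S)"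
proof -
  obtain h u where h: "continuous_map (prod_topology unit_interval B) B h"
    and u: "continuous_map B unit_interval u"
    and h0: "\<forall>b \<in> topspace B. h (0, b) = b" and ub0: "u b0 = 0"
    and h1: "\<forall>b \<in> topspace B. u b < 1 \<longrightarrow> h (1, b) = b0"
    using well_pointed_deformation[OF B wp] by blast
  have p: "continuous_map E B p" using fib by (simp add: fibration_def)
  have pB: "p e \<in> topspace B" if "e \<in> topspace E" for e
    using p that by (auto simp: continuous_map_def)
  let ?P = "prod_topology unit_interval E"
  have "continuous_map ?P (prod_topology unit_interval B) (\<lambda>z. (fst z, p (snd z)))"
    using continuous_map_fst[of unit_interval E] continuous_map_compose[OF continuous_map_snd p, of unit_interval]
    by (simp add: continuous_map_pairwise o_def)
  from continuous_map_compose[OF this h]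
  have hp: "continuous_map ?P B (\<lambda>z. h (fst z, p (snd z)))" by (simp add: o_def)
  obtain H where H: "continuous_map ?P E H" "\<forall>x \<in> topspace E. H (0, x) = x"
    "\<forall>t \<in> {0..1}. \<forall>x \<in> topspace E. p (H (t, x)) = h (t, p x)"
    using fibration_lift[OF fib _ _ _ continuous_map_id hp] E B h0 pB
    by (auto simp: cg_hausdorff_def)
  have up: "continuous_map ?P euclideanreal (\<lambda>z. u (p (snd z)))"
    using continuous_map_compose[OF continuous_map_compose[OF continuous_map_snd p, of unit_interval] u]
    by (simp add: o_def continuous_map_in_subtopology)
  have u01: "u (p e) \<in> {0..1}" if "e \<in> topspace E" for e
    using u pB[OF that] by (auto simp: continuous_map_def)
  have fs: "continuous_map ?P euclideanreal fst"
    using continuous_map_fst[of unit_interval E] by (simp add: continuous_map_in_subtopology)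
  \<comment> \<open>The available time shrinks with the distance function \<open>u\<close>. Up to
    \<tau> = 1/2 only \<open>H\<close> runs; the deformation of \<open>F\<close> occupies the second
    half.\<close>
  define \<tau> where "\<tau> z = fst z * (1 - u (p (snd z)))" for z
  have \<tau>: "continuous_map ?P euclideanreal \<tau>"
    unfolding \<tau>_def by (intro continuous_map_real_mult continuous_map_diff fs up) simp
  have \<tau>01: "0 \<le> \<tau> z \<and> \<tau> z \<le> 1" and \<tau>u: "\<tau> z \<le> 1 - u (p (snd z))" if "z \<in> topspace ?P" for z
    using u01[of "snd z"] that by (auto simp: \<tau>_def mult_le_one mult_left_le_one_le)
  have H1F: "H (1, e) \<in> topspace F" if "e \<in> topspace E" "u (p e) < 1" for e
  proof -
    have "H (1, e) \<in> topspace E" using H(1) that by (auto simp: continuous_map_def)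
    then show ?thesis using H(3) h1 that pB by (auto simp: F)
  qed
  have "\<exists>l'. homotopic_with (\<lambda>_. True) E E id l' \<and> (\<forall>x \<in> topspace F. l' x = l i (H (1, x)))"
    if i: "i \<in> J" for i
  proof -
    obtain L where L: "continuous_map (prod_topology unit_interval F) F L" "\<And>x. L (0, x) = x"
      "\<And>x. L (1, x) = l i x"
      using homotopic_with_trivialD[OF l[OF i]] by auto
    have LE: "continuous_map (prod_topology unit_interval F) E L"
      using L(1) by (simp add: F continuous_map_in_subtopology)
    define K where "K = (\<lambda>z. if \<tau> z \<le> 1/2 then H (2 * \<tau> z, snd z) else L (2 * \<tau> z - 1, H (1, snd z)))"
    have "continuous_map ?P E K"
      unfolding K_def
    proof (rule continuous_map_cases_le)
      show "continuous_map ?P euclideanreal \<tau>" by (rule \<tau>)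
      let ?Z = "subtopology ?P {z \<in> topspace ?P. \<tau> z \<le> 1/2}"
      have "continuous_map ?Z ?P (\<lambda>z. (2 * \<tau> z, snd z))"
        unfolding continuous_map_pairwise o_def fst_conv snd_conv continuous_map_in_subtopology
      proof (intro conjI)
        show "continuous_map ?Z euclideanreal (\<lambda>z. 2 * \<tau> z)"
          by (intro continuous_map_real_mult continuous_map_from_subtopology \<tau>) simp
        show "(\<lambda>z. 2 * \<tau> z) \<in> topspace ?Z \<rightarrow> {0..1}" using \<tau>01 by auto
        show "continuous_map ?Z E snd" by (intro continuous_map_from_subtopology continuous_map_snd)
      qed
      from continuous_map_compose[OF this H(1)]
      show "continuous_map ?Z E (\<lambda>z. H (2 * \<tau> z, snd z))" by (simp add: o_def)
      let ?Z = "subtopology ?P {z \<in> topspace ?P. 1/2 \<le> \<tau> z}"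
      have "continuous_map ?P ?P (\<lambda>z. (1, snd z))"
        using continuous_map_snd[of unit_interval E] by (simp add: continuous_map_pairwise o_def)
      from continuous_map_compose[OF this H(1)]
      have H1: "continuous_map ?P E (\<lambda>z. H (1, snd z))" by (simp add: o_def)
      have "continuous_map ?Z (prod_topology unit_interval F) (\<lambda>z. (2 * \<tau> z - 1, H (1, snd z)))"
        unfolding continuous_map_pairwise o_def fst_conv snd_conv
      proof
        have "continuous_map ?Z euclideanreal (\<lambda>z. 2 * \<tau> z - 1)"
          by (intro continuous_map_diff continuous_map_real_mult continuous_map_from_subtopology \<tau>) simp_all
        then show "continuous_map ?Z unit_interval (\<lambda>z. 2 * \<tau> z - 1)"
          using \<tau>01 by (auto simp: continuous_map_in_subtopology)
        \<comment> \<open>Here 1/2 \<le> \<tau> \<le> 1 - u forces u \<le> 1/2, so \<open>H\<close>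
          has already reached \<open>F\<close>.\<close>
        have "H (1, snd z) \<in> topspace F" if "z \<in> topspace ?Z" for z
          using that \<tau>u[of z] H1F[of "snd z"] by auto
        then show "continuous_map ?Z F (\<lambda>z. H (1, snd z))"
          using continuous_map_from_subtopology[OF H1] by (auto simp: F continuous_map_in_subtopology)
      qed
      from continuous_map_compose[OF this LE]
      show "continuous_map ?Z E (\<lambda>z. L (2 * \<tau> z - 1, H (1, snd z)))" by (simp add: o_def)
    next
      fix z assume "z \<in> topspace ?P" "\<tau> z = 1/2"
      then have "2 * \<tau> z = 1" "2 * \<tau> z - 1 = 0" by simp_all
      then show "H (2 * \<tau> z, snd z) = L (2 * \<tau> z - 1, H (1, snd z))" by (simp only: L(2))
    qed simp
    then have "homotopic_with (\<lambda>_. True) E E id (\<lambda>x. K (1, x))"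
      by (rule homotopic_with_trivialI) (auto simp: K_def H(2) \<tau>_def)
    \<comment> \<open>On \<open>F\<close> the result is \<open>l i\<close> at H (1, x), not at
      \<open>x\<close> itself. That is enough: H (1, x) is again in \<open>F\<close>, and the
      covering condition holds at every point of \<open>F\<close>.\<close>
    moreover have "K (1, x) = l i (H (1, x))" if "x \<in> topspace F" for x
      using that ub0 by (simp add: K_def \<tau>_def F L(3))
    ultimately show ?thesis by blast
  qed
  then obtain l' where l': "\<And>i. i \<in> J \<Longrightarrow> homotopic_with (\<lambda>_. True) E E id (l' i)"
    "\<And>i x. i \<in> J \<Longrightarrow> x \<in> topspace F \<Longrightarrow> l' i x = l i (H (1, x))" by metis
  have "\<exists>i \<in> J. l' i x \<in> S" if x: "x \<in> topspace F" for x
  proof -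
    have "H (1, x) \<in> topspace F" using H1F[of x] x ub0 by (auto simp: F)
    then obtain i where "i \<in> J" "l i (H (1, x)) \<in> S" using S by blast
    then show ?thesis using l'(2)[of i x] x by (intro bexI[of _ i]) simp_all
  qed
  with l'(1) show ?thesis by blast
qed

section \<open>Ganea fibrations\<close>

lemma continuous_map_ganea_path:
  assumes "j \<le> n"
  shows "continuous_map (ganea_space n A X f) (compact_open_topology unit_interval X) (\<lambda>\<gamma>. \<gamma> j)"
proof -
  let ?M = "\<lambda>_::nat. mapping_space unit_interval X"
  have "continuous_map (ganea_space n A X f) (cg_product ?M {..n}) id"
    unfolding ganea_space_def by (rule continuous_map_from_cg_subspace)
  then have "continuous_map (ganea_space n A X f) (product_topology ?M {..n}) id"
    using continuous_map_compose continuous_map_kification_id unfolding cg_product_def by fastforce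
  from continuous_map_compose[OF this continuous_map_product_projection[of j]] assms
  have "continuous_map (ganea_space n A X f) (mapping_space unit_interval X) (\<lambda>\<gamma>. \<gamma> j)"
    by (simp add: o_def)
  from continuous_map_compose[OF this[unfolded mapping_space_def] continuous_map_kification_id]
  show ?thesis by (simp add: o_def)
qed

lemma continuous_map_ganea_eval:
  assumes "j \<le> n"
  shows "continuous_map (prod_topology unit_interval (ganea_space n A X f)) X (\<lambda>(t, \<gamma>). \<gamma> j t)"
proof -
  have "continuous_map (prod_topology (ganea_space n A X f) unit_interval) X (\<lambda>(\<gamma>, t). \<gamma> j t)"
    using continuous_map_uncurry[OF unit_interval_compact(3,2) continuous_map_ganea_path[OF assms]] .
  from continuous_map_compose[OF continuous_map_swap this] show ?thesis
    by (simp add: o_def case_prod_unfold)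
qed

lemma continuous_map_ganea_map: "continuous_map (ganea_space n A X f) X ganea_map"
proof -
  have "continuous_map (ganea_space n A X f) (prod_topology unit_interval (ganea_space n A X f)) (\<lambda>\<gamma>. (0, \<gamma>))"
    by (simp add: continuous_map_pairwise o_def)
  from continuous_map_compose[OF this continuous_map_ganea_eval[of 0]] show ?thesis
    by (simp add: o_def ganea_map_def[abs_def])
qed

lemma ganea_space_D:
  assumes "\<gamma> \<in> topspace (ganea_space n A X f)"
  shows "j \<le> n \<Longrightarrow> \<gamma> j 0 = ganea_map \<gamma>" and "\<exists>j\<le>n. \<gamma> j 1 \<in> f ` topspace A"
proof -
  have "\<gamma> \<in> {\<gamma> \<in> Gamma_set n X. \<exists>j\<le>n. \<gamma> j 1 \<in> f ` topspace A}"
    using assms unfolding ganea_space_def cg_subspace_def topspace_kification topspace_subtopology by blast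
  then have \<gamma>: "\<gamma> \<in> Gamma_set n X" and *: "\<exists>j\<le>n. \<gamma> j 1 \<in> f ` topspace A" by blast+
  from \<gamma> show "j \<le> n \<Longrightarrow> \<gamma> j 0 = ganea_map \<gamma>"
    unfolding Gamma_set_def ganea_map_def by blast
  from * show "\<exists>j\<le>n. \<gamma> j 1 \<in> f ` topspace A" .
qed

lemma map_into_ganea_space:
  assumes P: "k_space P"
    and hom: "\<And>j. j \<le> n \<Longrightarrow> homotopic_with (\<lambda>_. True) P X b (e j)"
    and e: "\<And>z. z \<in> topspace P \<Longrightarrow> \<exists>j\<le>n. e j z \<in> f ` topspace A"
  shows "\<exists>\<Phi>. continuous_map P (ganea_space n A X f) \<Phi> \<and> (\<forall>z \<in> topspace P. ganea_map (\<Phi> z) = b z)"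
proof -
  let ?M = "\<lambda>_::nat. mapping_space unit_interval X"
  obtain H where H: "\<And>j. j \<le> n \<Longrightarrow> continuous_map (prod_topology unit_interval P) X (H j)"
    "\<And>j z. j \<le> n \<Longrightarrow> H j (0, z) = b z" "\<And>j z. j \<le> n \<Longrightarrow> H j (1, z) = e j z"
    using homotopic_with_trivialD[OF hom] by metis
  define \<Phi> where "\<Phi> z = (\<lambda>j\<in>{..n}. \<lambda>t\<in>{0..1}. H j (t, z))" for z
  have c: "continuous_map P (compact_open_topology unit_interval X) (\<lambda>z. \<lambda>t\<in>{0..1}. H j (t, z))"
    if "j \<le> n" for j
  proof -
    have "continuous_map (prod_topology P unit_interval) X (\<lambda>(z, t). H j (t, z))"
      using continuous_map_compose[OF continuous_map_swap H(1)[OF that]]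
      by (simp add: o_def case_prod_unfold)
    from continuous_map_curry[OF this] show ?thesis by simp
  qed
  have "continuous_map P (ganea_space n A X f) \<Phi>"
    unfolding ganea_space_def continuous_map_into_cg_subspace[OF P]
  proof
    have "continuous_map P (product_topology ?M {..n}) \<Phi>"
      unfolding continuous_map_componentwise
      using c by (auto simp: continuous_map_into_mapping_space[OF P] \<Phi>_def)
    then show "continuous_map P (cg_product ?M {..n}) \<Phi>"
      by (simp add: cg_product_def continuous_map_into_kification[OF P])
    have "\<Phi> z \<in> Gamma_set n X" if "z \<in> topspace P" for z
      using continuous_map_funspace[OF c] that H(2) by (auto simp: Gamma_set_def \<Phi>_def Pi_iff)
    moreover have "\<exists>j\<le>n. \<Phi> z j 1 \<in> f ` topspace A" if "z \<in> topspace P" for z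
      using e[OF that] H(3) by (auto simp: \<Phi>_def)
    ultimately show "\<Phi> \<in> topspace P \<rightarrow> {\<gamma> \<in> Gamma_set n X. \<exists>j\<le>n. \<gamma> j 1 \<in> f ` topspace A}" by blast
  qed
  moreover have "ganea_map (\<Phi> z) = b z" for z by (simp add: ganea_map_def \<Phi>_def H(2))
  ultimately show ?thesis by blast
qed

text \<open>The \<open>n + 1\<close> paths in the base are lifted, and each lift is prolonged by all \<open>m + 1\<close>
  deformations; whenever a path ends at the base point, one of its prolongations ends in \<open>g C\<close>.\<close>

lemma ganea_fibre_product_map:
  fixes E :: "'e topology" and B :: "'b topology"
  assumes fib: "fibration E B p" and E: "cg_hausdorff E" and B: "cg_hausdorff B"
    and F: "F = subtopology E {e \<in> topspace E. p e = b0}"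
    and l: "\<And>i. i \<le> m \<Longrightarrow> homotopic_with (\<lambda>_. True) E E id (l i)"
    and lF: "\<And>x. x \<in> topspace F \<Longrightarrow> \<exists>i\<le>m. l i x \<in> g ` topspace C"
    and \<rho>: "continuous_map X E \<rho>"
  shows "\<exists>\<Phi>. continuous_map
      (fibre_product X (ganea_space n (subtopology B {b0}) B id) (p \<circ> \<rho>) ganea_map)
      (ganea_space ((n + 1) * (m + 1) - 1) C E g) \<Phi> \<and>
    (\<forall>x \<gamma>. x \<in> topspace X \<longrightarrow> \<gamma> \<in> topspace (ganea_space n (subtopology B {b0}) B id) \<longrightarrow>
      (p \<circ> \<rho>) x = ganea_map \<gamma> \<longrightarrow> ganea_map (\<Phi> (x, \<gamma>)) = \<rho> x)"
proof -
  let ?G = "ganea_space n (subtopology B {b0}) B id"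
  define P where "P = fibre_product X ?G (p \<circ> \<rho>) ganea_map"
  have kP: "k_space P" by (simp add: P_def fibre_product_def cg_subspace_def)
  have Pt: "topspace P = {(x, \<gamma>). x \<in> topspace X \<and> \<gamma> \<in> topspace ?G \<and> p (\<rho> x) = ganea_map \<gamma>}"
    by (auto simp: P_def fibre_product_def cg_subspace_def)
  have Pid: "continuous_map P (prod_topology X ?G) id"
    unfolding P_def fibre_product_def by (rule continuous_map_from_cg_subspace)
  have P1: "continuous_map P E (\<lambda>z. \<rho> (fst z))"
    using continuous_map_compose[OF continuous_map_compose[OF Pid continuous_map_fst] \<rho>] by (simp add: o_def)
  have P2: "continuous_map P ?G snd"
    using continuous_map_compose[OF Pid continuous_map_snd] by simp
  have "\<exists>d. homotopic_with (\<lambda>_. True) P E (\<lambda>z. \<rho> (fst z)) d \<and> (\<forall>z \<in> topspace P. d z \<in> topspace E \<and> p (d z) = snd z j 1)"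
    if j: "j \<le> n" for j
  proof -
    have "continuous_map (prod_topology unit_interval P) (prod_topology unit_interval ?G) (\<lambda>z. (fst z, snd (snd z)))"
      using continuous_map_fst[of unit_interval P] continuous_map_compose[OF continuous_map_snd P2, of unit_interval]
      by (simp add: continuous_map_pairwise o_def)
    from continuous_map_compose[OF this continuous_map_ganea_eval[OF j]]
    have "continuous_map (prod_topology unit_interval P) B (\<lambda>z. snd (snd z) j (fst z))"
      by (simp add: o_def)
    moreover have "snd (snd (0, z)) j (fst (0::real, z)) = p (\<rho> (fst z))" if "z \<in> topspace P" for z
      using that ganea_space_D(1)[OF _ j] by (auto simp: Pt)
    ultimately obtain K where K: "continuous_map (prod_topology unit_interval P) E K"
      "\<forall>z \<in> topspace P. K (0, z) = \<rho> (fst z)"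
      "\<forall>t \<in> {0..1}. \<forall>z \<in> topspace P. p (K (t, z)) = snd (snd (t, z)) j (fst (t, z))"
      using fibration_lift[OF fib _ _ kP P1] E B unfolding cg_hausdorff_def by blast
    have "homotopic_with (\<lambda>_. True) P E (\<lambda>z. \<rho> (fst z)) (\<lambda>z. K (1, z))"
      using K(1,2) by (intro homotopic_with_trivialI) auto
    moreover have "K (1, z) \<in> topspace E" if "z \<in> topspace P" for z
      using that by (intro funcset_mem[OF continuous_map_funspace[OF K(1)]]) simp
    ultimately show ?thesis using K(3) by (intro exI[of _ "\<lambda>z. K (1, z)"]) simp
  qed
  then obtain d where d: "\<And>j. j \<le> n \<Longrightarrow> homotopic_with (\<lambda>_. True) P E (\<lambda>z. \<rho> (fst z)) (d j)"
    "\<And>j z. j \<le> n \<Longrightarrow> z \<in> topspace P \<Longrightarrow> d j z \<in> topspace E \<and> p (d j z) = snd z j 1"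
    by metis
  let ?N = "(n + 1) * (m + 1) - 1"
  \<comment> \<open>Pairs (j, i) with j \<le> n and i \<le> m are numbered by q = j (m + 1) + i,
    which runs from 0 to \<open>?N\<close>. The map \<open>e q\<close> is the end of the lift of
    path \<open>j\<close> prolonged by deformation \<open>i\<close>.\<close>
  define e where "e q = l (q mod (m + 1)) \<circ> d (q div (m + 1))" for q
  have "\<exists>\<Phi>. continuous_map P (ganea_space ?N C E g) \<Phi> \<and> (\<forall>z \<in> topspace P. ganea_map (\<Phi> z) = \<rho> (fst z))"
  proof (rule map_into_ganea_space[OF kP])
    fix q assume "q \<le> ?N"
    then have "q < (n + 1) * (m + 1)" by simp
    then have "q div (m + 1) < n + 1" by (rule less_mult_imp_div_less)
    then have j: "q div (m + 1) \<le> n" by simp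
    have i: "q mod (m + 1) \<le> m" using mod_less_divisor[of "m + 1" q] by simp
    have dc: "continuous_map P E (d (q div (m + 1)))"
      using homotopic_with_imp_continuous_maps[OF d(1)[OF j]] by blast
    show "homotopic_with (\<lambda>_. True) P E (\<lambda>z. \<rho> (fst z)) (e q)"
      using homotopic_with_trans[OF d(1)[OF j]] homotopic_with_compose_continuous_map_right[OF l[OF i] dc]
      by (simp add: e_def)
  next
    fix z assume z: "z \<in> topspace P"
    then have "snd z \<in> topspace ?G" by (auto simp: Pt)
    from ganea_space_D(2)[OF this] obtain j where j: "j \<le> n" "snd z j 1 = b0" by auto
    then have "d j z \<in> topspace F" using d(2)[OF j(1) z] by (simp add: F)
    then obtain i where i: "i \<le> m" "l i (d j z) \<in> g ` topspace C" using lF by blast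
    have "i + j * (m + 1) \<le> ?N"
      using i(1) mult_le_mono1[OF j(1), of "m + 1"] by (simp add: algebra_simps)
    moreover have "(i + j * (m + 1)) div (m + 1) = j" "(i + j * (m + 1)) mod (m + 1) = i"
      using div_mult_self1[of "m + 1" i j] mod_mult_self1[of i j "m + 1"] i(1) by simp_all
    ultimately show "\<exists>q\<le>?N. e q z \<in> g ` topspace C"
      using i(2) by (intro exI[of _ "i + j * (m + 1)"]) (simp add: e_def)
  qed
  then obtain \<Phi> where \<Phi>: "continuous_map P (ganea_space ?N C E g) \<Phi>"
    "\<And>z. z \<in> topspace P \<Longrightarrow> ganea_map (\<Phi> z) = \<rho> (fst z)" by blast
  show ?thesis
  proof (intro exI[of _ \<Phi>] conjI allI impI)
    show "continuous_map (fibre_product X ?G (p \<circ> \<rho>) ganea_map) (ganea_space ?N C E g) \<Phi>"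
      using \<Phi>(1) by (simp add: P_def)
    fix x \<gamma> assume "x \<in> topspace X" "\<gamma> \<in> topspace ?G" "(p \<circ> \<rho>) x = ganea_map \<gamma>"
    then show "ganea_map (\<Phi> (x, \<gamma>)) = \<rho> x" using \<Phi>(2)[of "(x, \<gamma>)"] by (simp add: Pt)
  qed
qed

section \<open>The product inequality\<close>

text \<open>The homotopy on \<open>B\<close>, composed with \<open>p\<close>, is lifted with the
  identity of \<open>E\<close> as its start, and \<rho> is the end of the lift. Since it must begin
  at the identity, the homotopy of a homotopy section is reversed before use.\<close>

lemma fibration_lift_homotopy_from_id:
  fixes E :: "'e topology" and B :: "'b topology"
  assumes fib: "fibration E B p" and E: "cg_hausdorff E" and B: "cg_hausdorff B"
    and hom: "homotopic_with (\<lambda>_. True) B B id q"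
  shows "\<exists>\<rho>. homotopic_with (\<lambda>_. True) E E id \<rho> \<and> (\<forall>e \<in> topspace E. p (\<rho> e) = q (p e))"
proof -
  obtain R where R: "continuous_map (prod_topology unit_interval B) B R" "\<And>b. R (0, b) = b" "\<And>b. R (1, b) = q b"
    using homotopic_with_trivialD[OF hom] by auto
  have p: "continuous_map E B p" using fib by (simp add: fibration_def)
  have "continuous_map (prod_topology unit_interval E) (prod_topology unit_interval B) (\<lambda>z. (fst z, p (snd z)))"
    using continuous_map_fst[of unit_interval E] continuous_map_compose[OF continuous_map_snd p, of unit_interval]
    by (simp add: continuous_map_pairwise o_def)
  from continuous_map_compose[OF this R(1)]
  have "continuous_map (prod_topology unit_interval E) B (\<lambda>z. R (fst z, p (snd z)))" by (simp add: o_def)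
  from fibration_lift[OF fib _ _ _ continuous_map_id this] E B
  obtain K where K: "continuous_map (prod_topology unit_interval E) E K" "\<forall>x \<in> topspace E. K (0, x) = x"
    "\<forall>t \<in> {0..1}. \<forall>x \<in> topspace E. p (K (t, x)) = R (t, p x)"
    by (auto simp: cg_hausdorff_def R(2))
  have "homotopic_with (\<lambda>_. True) E E id (\<lambda>x. K (1, x))"
    using K(1,2) by (intro homotopic_with_trivialI) auto
  then show ?thesis using K(3) R(3) by (intro exI[of _ "\<lambda>x. K (1, x)"]) auto
qed

lemma Q_secat_le_product:
  fixes E :: "'e topology" and B :: "'b topology"
  assumes fib: "fibration E B p" and E: "cg_hausdorff E" and B: "cg_hausdorff B"
    and wp: "well_pointed B b0"
    and F: "F = subtopology E {e \<in> topspace E. p e = b0}" "CW_type F"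
    and n: "Q_cat k B b0 = enat n" and m: "secat A F f = enat m"
    and fg: "f ` topspace A \<subseteq> g ` topspace C"
  shows "Q_secat k C E g \<le> enat ((n + 1) * (m + 1) - 1)"
proof -
  let ?G = "ganea_space n (subtopology B {b0}) B id"
  let ?N = "(n + 1) * (m + 1) - 1"
  let ?G' = "ganea_space ?N C E g"
  have p: "continuous_map E B p" using fib by (simp add: fibration_def)
  obtain l0 where l0: "\<forall>i\<le>m. homotopic_with (\<lambda>_. True) F F id (l0 i)"
    "\<forall>x \<in> topspace F. \<exists>i\<le>m. l0 i x \<in> f ` topspace A"
    using secat_deformations[OF F(2) m] by blast
  have l0C: "\<exists>i\<in>{..m}. l0 i x \<in> g ` topspace C" if "x \<in> topspace F" for x
    using bspec[OF l0(2) that] fg by (meson atMost_iff subsetD)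
  have "\<exists>l. (\<forall>i\<in>{..m}. homotopic_with (\<lambda>_. True) E E id (l i)) \<and>
      (\<forall>x \<in> topspace F. \<exists>i\<in>{..m}. l i x \<in> g ` topspace C)"
    by (rule fibre_deformations_extend[OF fib E B wp F(1), where l = l0]) (use l0(1) l0C in simp_all)
  then obtain l where l: "\<And>i. i \<le> m \<Longrightarrow> homotopic_with (\<lambda>_. True) E E id (l i)"
    "\<And>x. x \<in> topspace F \<Longrightarrow> \<exists>i\<le>m. l i x \<in> g ` topspace C"
    unfolding atMost_iff Bex_def Ball_def by blast
  have "has_homotopy_section (Q_space k ?G B ganea_map) B (Q_map k ganea_map)"
    using Inf_enat_attained[OF n[unfolded Q_cat_def Q_secat_def]] by auto
  then obtain s where s: "continuous_map B (Q_space k ?G B ganea_map) s"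
    and hom: "homotopic_with (\<lambda>_. True) B B (Q_map k ganea_map \<circ> s) id"
    unfolding has_homotopy_section_def by blast
  obtain \<rho> where \<rho>: "homotopic_with (\<lambda>_. True) E E id \<rho>"
    "\<forall>e \<in> topspace E. p (\<rho> e) = (Q_map k ganea_map \<circ> s) (p e)"
    using fibration_lift_homotopy_from_id[OF fib E B homotopic_with_symD[OF hom]] by blast
  have \<rho>c: "continuous_map E E \<rho>" using homotopic_with_imp_continuous_maps[OF \<rho>(1)] by blast
  obtain \<Phi> where \<Phi>: "continuous_map (fibre_product E ?G (p \<circ> \<rho>) ganea_map) ?G' \<Phi>"
    "\<And>x \<gamma>. x \<in> topspace E \<Longrightarrow> \<gamma> \<in> topspace ?G \<Longrightarrow> (p \<circ> \<rho>) x = ganea_map \<gamma> \<Longrightarrow> ganea_map (\<Phi> (x, \<gamma>)) = \<rho> x"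
    using ganea_fibre_product_map[OF fib E B F(1) l \<rho>c, of n] by blast
  have "\<exists>\<sigma>. continuous_map E (Q_space k ?G' E ganea_map) \<sigma> \<and> (\<forall>x \<in> topspace E. Q_map k ganea_map (\<sigma> x) = \<rho> x)"
  \<comment> \<open>Although \<open>s\<close> is a section only up to homotopy,
    \<open>s \<circ> p\<close> lies strictly over \<open>p \<circ> \<rho>\<close>, so the transfer
    applies with that as the base map. The outcome covers \<rho>, which is homotopic to the
    identity.\<close>
  proof (rule Q_section_transfer[where s = "s \<circ> p" and r = "p \<circ> \<rho>" and \<Phi> = \<Phi>])
    show "k_space E" "Hausdorff_space E" "Hausdorff_space B" using E B by (simp_all add: cg_hausdorff_def)
    show "k_space ?G" by (simp add: ganea_space_def cg_subspace_def)
    show "continuous_map ?G B ganea_map" by (rule continuous_map_ganea_map)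
    show "continuous_map E B (p \<circ> \<rho>)" using \<rho>c p by (rule continuous_map_compose)
    show "continuous_map E (Q_space k ?G B ganea_map) (s \<circ> p)" using p s by (rule continuous_map_compose)
    show "Q_map k ganea_map ((s \<circ> p) x) = (p \<circ> \<rho>) x" if "x \<in> topspace E" for x
      using \<rho>(2) that by simp
    show "\<rho> \<in> topspace E \<rightarrow> topspace E" using \<rho>c by (rule continuous_map_funspace)
  qed (use \<Phi> in blast)+
  then obtain \<sigma> where \<sigma>: "continuous_map E (Q_space k ?G' E ganea_map) \<sigma>"
    "\<forall>x \<in> topspace E. Q_map k ganea_map (\<sigma> x) = \<rho> x" by blast
  obtain h where "continuous_map (prod_topology unit_interval E) E h" "\<And>x. h (0, x) = \<rho> x" "\<And>x. h (1, x) = x"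
    using homotopic_with_trivialD[OF homotopic_with_symD[OF \<rho>(1)]] by auto
  then have "homotopic_with (\<lambda>_. True) E E (Q_map k ganea_map \<circ> \<sigma>) id"
    using \<sigma>(2) by (intro homotopic_with_trivialI) auto
  with \<sigma>(1) have "has_homotopy_section (Q_space k ?G' E ganea_map) E (Q_map k ganea_map)"
    unfolding has_homotopy_section_def by blast
  then show ?thesis unfolding Q_secat_def by (intro Inf_lower) blast
qed

theorem theorem3p8:
  fixes E :: "'e topology" and B :: "'b topology" and \<pi> :: "'e \<Rightarrow> 'b"
    and A :: "'a topology" and C :: "'c topology"
    and f :: "'a \<Rightarrow> 'e" and g :: "'c \<Rightarrow> 'e" and \<phi> :: "'a \<Rightarrow> 'c"
    and a0 :: 'a and c0 :: 'c and e0 :: 'e and b0 :: 'b and k :: nat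
  defines "F \<equiv> subtopology E {e \<in> topspace E. \<pi> e = b0}"
  assumes "admissible_space B" and "well_pointed B b0" and "path_connected_space B"
    and "fibration E B \<pi>" and "\<pi> e0 = b0"
    and "admissible_cofibration A a0 F e0 f"
    and "admissible_cofibration C c0 E e0 g"
    and "continuous_map A C \<phi>" and "\<And>a. a \<in> topspace A \<Longrightarrow> g (\<phi> a) = f a"
  shows "Q_secat k C E g \<le> (Q_cat k B b0 + 1) * (secat A F f + 1) - 1"
proof (cases "Q_cat k B b0")
  case n: (enat n)
  show ?thesis
  proof (cases "secat A F f")
    case m: (enat m)
    have B: "cg_hausdorff B" using assms(2) by (simp add: admissible_space_def)
    have E: "cg_hausdorff E" and F: "CW_type F"
      using assms(7,8) by (simp_all add: admissible_cofibration_def admissible_space_def)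
    have "f ` topspace A \<subseteq> g ` topspace C"
    proof
      fix y assume "y \<in> f ` topspace A"
      then obtain a where a: "a \<in> topspace A" "y = f a" by blast
      then have "\<phi> a \<in> topspace C" using continuous_map_funspace[OF assms(9)] by blast
      then show "y \<in> g ` topspace C" using assms(10)[OF a(1)] a(2) by (metis imageI)
    qed
    then have "Q_secat k C E g \<le> enat ((n + 1) * (m + 1) - 1)"
      by (rule Q_secat_le_product[OF assms(5) E B assms(3) F_def[THEN meta_eq_to_obj_eq] F n m])
    \<comment> \<open>Truncated subtraction is harmless here, as the product is at least 1.\<close>
    also have "enat ((n + 1) * (m + 1) - 1) = (enat n + 1) * (enat m + 1) - 1"
      by (simp add: one_enat_def)
    finally show ?thesis by (simp add: n m)
  next
    \<comment> \<open>In \<open>enat\<close> the product of 0 and \<infinity> is 0; the added 1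
      keeps the finite factor positive, so the right-hand side is \<infinity>.\<close>
    case infinity
    then show ?thesis by (simp add: n one_enat_def)
  qed
next
  case infinity
  then show ?thesis by (cases "secat A F f") (simp_all add: one_enat_def)
qed

end
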